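(* Let $D\subset\mathbb{R}^d$ ($d\in\{1,2,3\}$) be a bounded Lipschitz domain whose boundary is split into a Dirichlet part $\Gamma_D$ and a Neumann part $\Gamma_N=\partial D\setminus\Gamma_D$, and let $(\Omega,\mathcal F,\mathbb P)$ be a complete probability space. Let $H:=L^2_{\mathbb P}(\Omega)\otimes H^1_{\Gamma_D}(D)$, where $H^1_{\Gamma_D}(D)=\{v\in H^1(D): v|_{\Gamma_D}=0\}$. Let $\mathbf A(\omega,\mathbf x)$ be a measurable field of symmetric $d\times d$ matrices such that there are $0<\alpha_{\min}\le\alpha_{\max}<\infty$ with $\alpha_{\min}|\mathbf a|^2\le \mathbf a^T\mathbf A(\omega,\mathbf x)\mathbf a\le\alpha_{\max}|\mathbf a|^2$ for all $\mathbf a\in\mathbb R^d$, for $\mathbb P$-a.e. $\omega$ and a.e. $\mathbf x$. Let $\mathbf A_0(\omega,\mathbf x)$ be a measurable, essentially bounded field of symmetric $d\times d$ matrices. Define $$B(u,v)=\mathbb E\Big[\int_D \mathbf A\nabla u\cdot\nabla v\,d\mathbf x\Big],\qquad B_0(u,v)=\mathbb E\Big[\int_D \mathbf A_0\nabla u\cdot\nabla v\,d\mathbf x\Big],$$ $\|v\|_B:=\sqrt{B(v,v)}$, let $F:H\to\mathbb R$ be a continuous linear functional (e.g. $F(v)=\mathbb E[\int_D f v\,d\mathbf x+\int_{\Gamma_N}\sigma v\,ds]$), and let $Q:H\to\mathbb R$ be a continuous linear functional (the quantity of interest). Let $u\in H$ be the unique solution of $B(u,v)=F(v)$ for all $v\in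 H$, and let $u_0,w_0\in H$ satisfy $B_0(u_0,v)=F(v)$ and $B_0(v,w_0)=Q(v)$ for all $v\in H$. Set $e_0:=u-u_0$ and $\mathbf I_0:=\mathbf I-\mathbf A^{-1}\mathbf A_0$, and for $g,v\in H$ define $$R_g(v):=\mathbb E\Big[\int_D \mathbf A\,\mathbf I_0\nabla g\cdot\nabla v\,d\mathbf x\Big].$$ Fix a real number $s\neq 0$, and define $$\zeta_{\mathrm{upp}}^2:=\mathbb E\Big[\int_D \mathbf I_0\nabla u_0\cdot\mathbf A\,\mathbf I_0\nabla u_0\,d\mathbf x\Big],\qquad \xi_{\mathrm{upp}}^2:=\mathbb E\Big[\int_D \mathbf I_0\nabla w_0\cdot\mathbf A\,\mathbf I_0\nabla w_0\,d\mathbf x\Big],$$ $$(\eta^{\pm}_{\mathrm{upp}})^2:=s^2\zeta_{\mathrm{upp}}^2+s^{-2}\xi_{\mathrm{upp}}^2\pm\mathbb E\Big[2\int_D \mathbf I_0\nabla u_0\cdot\mathbf A\,\mathbf I_0\nabla w_0\,d\mathbf x\Big],$$ $$\theta^{\pm}:=\frac{B(u_0,w_0)\,R_{u_0}(su_0\pm s^{-1}w_0)-B(u_0,u_0)\,R_{w_0}(su_0\pm s^{-1}w_0)}{B(u_0,w_0)\,R_{w_0}(su_0\pm s^{-1}w_0)-B(w_0,w_0)\,R_{u_0}(su_0\pm s^{-1}w_0)},\qquad \eta^{\pm}_{\mathrm{low}}:=\frac{|R_{su_0\pm s^{-1}w_0}(u_0+\theta^{\pm}w_0)|}{\|u_0+\theta^{\pm}w_0\|_B},$$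 assuming the denominators in $\theta^\pm$ and $\eta^\pm_{\mathrm{low}}$ are nonzero. Then, with $$\eta_{\mathrm{low}}:=\tfrac14(\eta^{+}_{\mathrm{low}})^2-\tfrac14(\eta^{-}_{\mathrm{upp}})^2-R_{u_0}(w_0),\qquad \eta_{\mathrm{upp}}:=\tfrac14(\eta^{+}_{\mathrm{upp}})^2-\tfrac14(\eta^{-}_{\mathrm{low}})^2-R_{u_0}(w_0),$$ the modeling error in the quantity of interest satisfies $\eta_{\mathrm{low}}\le Q(e_0)\le\eta_{\mathrm{upp}}$.
   Context: Here $L^2_{\mathbb P}(\Omega)\otimes H^1_{\Gamma_D}(D)$ is identified with the space of square-integrable $H^1_{\Gamma_D}(D)$-valued random variables, and $\mathbb E$ denotes expectation with respect to $\mathbb P$. The uniform bounds on $\mathbf A$ make $B$ a continuous coercive symmetric bilinear form on $H$, so $u$ exists and is unique by Lax–Milgram; $u_0,w_0$ are solutions of the surrogate primal and adjoint problems in which $\mathbf A$ is replaced by the approximation $\mathbf A_0$. *)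

theory Defs
  imports "HOL-Probability.Probability"
begin

definition lipschitz_domain :: "(real^'n) set \<Rightarrow> bool" where
  "lipschitz_domain D \<longleftrightarrow> open D \<and> connected D \<and> bounded D \<and> D \<noteq> {} \<and>
     (\<forall>p\<in>frontier D. \<exists>r>0. \<exists>(nu::real^'n) (h::real^'n \<Rightarrow> real) L.
        norm nu = 1 \<and> L-lipschitz_on {y. y \<bullet> nu = 0} h \<and>
        D \<inter> ball p r = {x \<in> ball p r. x \<bullet> nu < h (x - (x \<bullet> nu) *\<^sub>R nu)})"

definition hausdorff_null :: "nat \<Rightarrow> (real^'n) set \<Rightarrow> bool" where
  "hausdorff_null k S \<longleftrightarrow> (\<forall>\<epsilon>>0. \<exists>(I::nat set) c r.
      (\<forall>i\<in>I. r i > 0) \<and> S \<subseteq> (\<Union>i\<in>I. ball (c i) (r i)) \<and>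
      (\<Sum>i. if i \<in> I then ennreal (r i ^ k) else 0) < ennreal \<epsilon>)"

definition test_fun :: "(real^'n) set \<Rightarrow> (real^'n \<Rightarrow> real) \<Rightarrow> (real^'n \<Rightarrow> real^'n) \<Rightarrow> bool" where
  "test_fun D \<phi> \<phi>' \<longleftrightarrow> continuous_on UNIV \<phi>' \<and>
     (\<forall>x. (\<phi> has_derivative (\<lambda>h. \<phi>' x \<bullet> h)) (at x)) \<and>
     compact (closure {x. \<phi> x \<noteq> 0}) \<and> closure {x. \<phi> x \<noteq> 0} \<subseteq> D"

definition sq_int_on :: "(real^'n) set \<Rightarrow> (real^'n \<Rightarrow> real) \<Rightarrow> bool" where
  "sq_int_on D f \<longleftrightarrow> f \<in> borel_measurable (lebesgue_on D) \<and> set_integrable lebesgue D (\<lambda>x. (f x)\<^sup>2)"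

definition has_weak_gradient :: "(real^'n) set \<Rightarrow> (real^'n \<Rightarrow> real) \<Rightarrow> (real^'n \<Rightarrow> real^'n) \<Rightarrow> bool" where
  "has_weak_gradient D v g \<longleftrightarrow> sq_int_on D v \<and> (\<forall>i. sq_int_on D (\<lambda>x. g x $ i)) \<and>
     (\<forall>\<phi> \<phi>'. test_fun D \<phi> \<phi>' \<longrightarrow>
        (\<forall>i. (LINT x:D|lebesgue. v x * \<phi>' x $ i) = - (LINT x:D|lebesgue. g x $ i * \<phi> x)))"

definition H1 :: "(real^'n) set \<Rightarrow> (real^'n \<Rightarrow> real) set" where
  "H1 D = {v. \<exists>g. has_weak_gradient D v g}"

text \<open>Vanishing trace on Gamma: for H^{d-1}-almost every boundary point p in Gamma,
the mean of |v| over ball p r \<inter> D tends to 0 as r \<rightarrow> 0+.  (For Lipschitz domains this is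
equivalent to the trace of v vanishing surface-a.e. on Gamma.)\<close>
definition zero_trace_on :: "(real^'n) set \<Rightarrow> (real^'n) set \<Rightarrow> (real^'n \<Rightarrow> real) \<Rightarrow> bool" where
  "zero_trace_on D \<Gamma> v \<longleftrightarrow> (\<exists>N. hausdorff_null (CARD('n) - 1) N \<and>
     (\<forall>p\<in>\<Gamma> - N. ((\<lambda>r. (LINT x:(ball p r \<inter> D)|lebesgue. \<bar>v x\<bar>) / measure lebesgue (ball p r \<inter> D))
                     \<longlongrightarrow> 0) (at_right 0)))"

definition H1_0 :: "(real^'n) set \<Rightarrow> (real^'n) set \<Rightarrow> (real^'n \<Rightarrow> real) set" where
  "H1_0 D \<Gamma>D = {v \<in> H1 D. zero_trace_on D \<Gamma>D v}"

definition is_rgrad :: "'w measure \<Rightarrow> (real^'n) set \<Rightarrow> ('w \<Rightarrow> real^'n \<Rightarrow> real)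
    \<Rightarrow> ('w \<Rightarrow> real^'n \<Rightarrow> real^'n) \<Rightarrow> bool" where
  "is_rgrad M D v G \<longleftrightarrow> (\<lambda>(\<omega>,x). G \<omega> x) \<in> borel_measurable (M \<Otimes>\<^sub>M lborel) \<and>
     (AE \<omega> in M. has_weak_gradient D (v \<omega>) (G \<omega>))"

definition rgrad :: "'w measure \<Rightarrow> (real^'n) set \<Rightarrow> ('w \<Rightarrow> real^'n \<Rightarrow> real) \<Rightarrow> 'w \<Rightarrow> real^'n \<Rightarrow> real^'n" where
  "rgrad M D v = (SOME G. is_rgrad M D v G)"

definition EInt :: "'w measure \<Rightarrow> (real^'n) set \<Rightarrow> ('w \<Rightarrow> real^'n \<Rightarrow> real) \<Rightarrow> real" where
  "EInt M D f = (LINT \<omega>|M. (LINT x:D|lebesgue. f \<omega> x))"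

definition Hspace :: "'w measure \<Rightarrow> (real^'n) set \<Rightarrow> (real^'n) set \<Rightarrow> ('w \<Rightarrow> real^'n \<Rightarrow> real) set" where
  "Hspace M D \<Gamma>D = {v. (\<lambda>(\<omega>,x). v \<omega> x) \<in> borel_measurable (M \<Otimes>\<^sub>M lborel) \<and>
       (\<exists>G. is_rgrad M D v G) \<and> (AE \<omega> in M. v \<omega> \<in> H1_0 D \<Gamma>D) \<and>
       integrable M (\<lambda>\<omega>. LINT x:D|lebesgue. (v \<omega> x)\<^sup>2 + (norm (rgrad M D v \<omega> x))\<^sup>2)}"

definition Hnorm :: "'w measure \<Rightarrow> (real^'n) set \<Rightarrow> ('w \<Rightarrow> real^'n \<Rightarrow> real) \<Rightarrow> real" where
  "Hnorm M D v = sqrt (EInt M D (\<lambda>\<omega> x. (v \<omega> x)\<^sup>2 + (norm (rgrad M D v \<omega> x))\<^sup>2))"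

definition bounded_linear_fun_on :: "'w measure \<Rightarrow> (real^'n) set \<Rightarrow> (real^'n) set
    \<Rightarrow> (('w \<Rightarrow> real^'n \<Rightarrow> real) \<Rightarrow> real) \<Rightarrow> bool" where
  "bounded_linear_fun_on M D \<Gamma>D F \<longleftrightarrow>
     (\<forall>u\<in>Hspace M D \<Gamma>D. \<forall>v\<in>Hspace M D \<Gamma>D. \<forall>a b::real.
        F (\<lambda>\<omega> x. a * u \<omega> x + b * v \<omega> x) = a * F u + b * F v) \<and>
     (\<exists>C. \<forall>v\<in>Hspace M D \<Gamma>D. \<bar>F v\<bar> \<le> C * Hnorm M D v)"

definition Bform :: "'w measure \<Rightarrow> (real^'n) set \<Rightarrow> ('w \<Rightarrow> real^'n \<Rightarrow> real^'n^'n)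
    \<Rightarrow> ('w \<Rightarrow> real^'n \<Rightarrow> real) \<Rightarrow> ('w \<Rightarrow> real^'n \<Rightarrow> real) \<Rightarrow> real" where
  "Bform M D K u v = EInt M D (\<lambda>\<omega> x. (K \<omega> x *v rgrad M D u \<omega> x) \<bullet> rgrad M D v \<omega> x)"

definition I0 :: "('w \<Rightarrow> real^'n \<Rightarrow> real^'n^'n) \<Rightarrow> ('w \<Rightarrow> real^'n \<Rightarrow> real^'n^'n) \<Rightarrow> 'w \<Rightarrow> real^'n \<Rightarrow> real^'n^'n" where
  "I0 A A0 \<omega> x = mat 1 - matrix_inv (A \<omega> x) ** A0 \<omega> x"

definition Rres :: "'w measure \<Rightarrow> (real^'n) set \<Rightarrow> ('w \<Rightarrow> real^'n \<Rightarrow> real^'n^'n) \<Rightarrow> ('w \<Rightarrow> real^'n \<Rightarrow> real^'n^'n)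
    \<Rightarrow> ('w \<Rightarrow> real^'n \<Rightarrow> real) \<Rightarrow> ('w \<Rightarrow> real^'n \<Rightarrow> real) \<Rightarrow> real" where
  "Rres M D A A0 g v = EInt M D (\<lambda>\<omega> x. (A \<omega> x *v (I0 A A0 \<omega> x *v rgrad M D g \<omega> x)) \<bullet> rgrad M D v \<omega> x)"

definition Jform :: "'w measure \<Rightarrow> (real^'n) set \<Rightarrow> ('w \<Rightarrow> real^'n \<Rightarrow> real^'n^'n) \<Rightarrow> ('w \<Rightarrow> real^'n \<Rightarrow> real^'n^'n)
    \<Rightarrow> ('w \<Rightarrow> real^'n \<Rightarrow> real) \<Rightarrow> ('w \<Rightarrow> real^'n \<Rightarrow> real) \<Rightarrow> real" where
  "Jform M D A A0 g h = EInt M D (\<lambda>\<omega> x. (I0 A A0 \<omega> x *v rgrad M D g \<omega> x) \<bullet>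
                                        (A \<omega> x *v (I0 A A0 \<omega> x *v rgrad M D h \<omega> x)))"

definition lc :: "real \<Rightarrow> ('w \<Rightarrow> real^'n \<Rightarrow> real) \<Rightarrow> real \<Rightarrow> ('w \<Rightarrow> real^'n \<Rightarrow> real) \<Rightarrow> 'w \<Rightarrow> real^'n \<Rightarrow> real" where
  "lc a u b v = (\<lambda>\<omega> x. a * u \<omega> x + b * v \<omega> x)"

end

theory Submission
  imports Defs
begin

text \<open>Work with gradient fields in the energy inner product of \<open>A\<close>. With \<open>p = I0 grad u0\<close>,
  \<open>q = I0 grad w0\<close> and \<open>z = grad e0\<close>, the primal equations say that \<open>p + z\<close> is orthogonal to all
  gradients, and the adjoint equation gives \<open>Q e0 = - R (u0, w0) - \<langle>q, z\<rangle>\<close>. The classical argument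
  polarises \<open>\<langle>q, z\<rangle>\<close> with the exact adjoint solution, whose existence needs Lax--Milgram. Here it
  suffices to project to the span of \<open>z\<close> and the one gradient that occurs in the lower estimate.
  What remains is measure theory: gradients are chosen
  by \<open>SOME\<close>, so their linearity rests on uniqueness of weak gradients.\<close>

subsection \<open>The fundamental lemma of the calculus of variations\<close>

text \<open>The projection may be restricted because \<open>energy q z\<close> sees \<open>q\<close>
  only through its component along \<open>z\<close>, and for every span that contains
  \<open>z\<close> and otherwise consists of gradients the projection of \<open>p\<close> is still
  \<open>- z\<close>. The factor 1/4 comes from polarisation, and the weights \<open>s\<close> and
  \<open>1/s\<close> cancel in the mixed product. Both estimates are one inequality with a sign
  \<open>\<sigma>\<close>, which is 1 for the upper and -1 for the lower bound. Two obstacles shape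
  the rest. \<open>p\<close> and \<open>q\<close> contain \<open>matrix_inv\<close> of a matrix that
  is elliptic only almost everywhere, so their measurability is not evident; a Cramer formula
  supplies measurable versions, and completeness of both measures allows the exchange under the
  integral. Moreover \<open>EInt\<close> is an iterated Bochner integral with value 0 at
  non-integrable integrands; its linearity is therefore derived from integrability over the product
  measure.\<close>

lemma pos_part_power2_has_real_derivative:
  "((\<lambda>y::real. (max 0 y)\<^sup>2) has_real_derivative 2 * max 0 x) (at x)"
proof (cases x "0::real" rule: linorder_cases)
  case less
  have "((\<lambda>y::real. 0) has_real_derivative 0) (at x)" by simp
  then have "((\<lambda>y::real. (max 0 y)\<^sup>2) has_real_derivative 0) (at x)"
    by (rule DERIV_cong_ev[OF refl _ refl, THEN iffD1, rotated])
      (use eventually_nhds_in_open[of "{..<0}" x] less in \<open>auto elim!: eventually_mono\<close>)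
  then show ?thesis using less by simp
next
  case greater
  have "((\<lambda>y::real. y\<^sup>2) has_real_derivative 2 * x) (at x)"
    by (auto intro!: derivative_eq_intros)
  then have "((\<lambda>y::real. (max 0 y)\<^sup>2) has_real_derivative 2 * x) (at x)"
    by (rule DERIV_cong_ev[OF refl _ refl, THEN iffD1, rotated])
      (use eventually_nhds_in_open[of "{0<..}" x] greater in \<open>auto elim!: eventually_mono\<close>)
  then show ?thesis using greater by simp
next
  case equal
  have "((\<lambda>h::real. (max 0 h)\<^sup>2 / h) \<longlongrightarrow> 0) (at 0)"
  proof (rule Lim_null_comparison)
    show "\<forall>\<^sub>F h in at (0::real). norm ((max 0 h)\<^sup>2 / h) \<le> \<bar>h\<bar>"
      by (intro always_eventually) (auto simp: max_def power2_eq_square)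
    show "((\<lambda>h::real. \<bar>h\<bar>) \<longlongrightarrow> 0) (at 0)" by (rule tendsto_eq_intros | simp)+
  qed
  then show ?thesis unfolding DERIV_def using equal by simp
qed

text \<open>Squaring the positive part makes each factor continuously differentiable, which is all
  the smoothness that \<open>test_fun\<close> asks for.\<close>

definition box_bump :: "real^'n \<Rightarrow> real^'n \<Rightarrow> real^'n \<Rightarrow> real" where
  "box_bump a b x = (\<Prod>i\<in>UNIV. (max 0 ((x $ i - a $ i) * (b $ i - x $ i)))\<^sup>2)"

lemma box_bump_nonneg: "box_bump a b x \<ge> 0"
  unfolding box_bump_def by (intro prod_nonneg) auto

lemma box_bump_eq_0_iff:
  fixes a b x :: "real^'n"
  assumes "\<And>i. a $ i < b $ i"
  shows "box_bump a b x = 0 \<longleftrightarrow> x \<notin> box a b"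
proof -
  have "(x $ i - a $ i) * (b $ i - x $ i) \<le> 0 \<longleftrightarrow> \<not> (a $ i < x $ i \<and> x $ i < b $ i)" for i
    using assms[of i] by (auto simp: mult_le_0_iff)
  then have "(max 0 ((x $ i - a $ i) * (b $ i - x $ i)))\<^sup>2 = 0 \<longleftrightarrow> \<not> (a $ i < x $ i \<and> x $ i < b $ i)" for i
    unfolding power_eq_0_iff max_def by (metis (full_types) linorder_le_cases order_antisym zero_less_numeral)
  then show ?thesis
    unfolding box_bump_def by (simp add: prod_zero_iff mem_box_cart)
qed

text \<open>The function vanishes exactly where the bump does (for nonzero \<open>k\<close>), so its
  support stays in the closed box. As \<open>k\<close> grows it increases to the indicator of the
  open box with values in [0,1), which makes it suitable for dominated convergence.\<close>

lemma box_bump_test_fun: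
  fixes a b :: "real^'n" and k :: real
  assumes ab: "\<And>i. a $ i < b $ i" and sub: "cbox a b \<subseteq> D"
  shows "\<exists>\<phi>'. test_fun D (\<lambda>x. 1 - exp (- k * box_bump a b x)) \<phi>'"
proof -
  define P where "P = box_bump a b"
  define f where "f = (\<lambda>i (x::real^'n). (max 0 ((x $ i - a $ i) * (b $ i - x $ i)))\<^sup>2)"
  define f' where "f' = (\<lambda>i (x::real^'n).
     2 * max 0 ((x $ i - a $ i) * (b $ i - x $ i)) * (a $ i + b $ i - 2 * x $ i))"
  have df: "(f i has_derivative (\<lambda>h. f' i x * h $ i)) (at x)" for i x
  proof -
    have l: "((\<lambda>x::real^'n. (x $ i - a $ i) * (b $ i - x $ i)) has_derivative
       (\<lambda>h. (a $ i + b $ i - 2 * x $ i) * h $ i)) (at x)"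
      by (auto intro!: derivative_eq_intros bounded_linear.has_derivative[OF bounded_linear_vec_nth] simp: algebra_simps)
    show ?thesis
      using has_derivative_compose[OF l
          pos_part_power2_has_real_derivative[unfolded has_field_derivative_def]]
      by (simp add: f_def f'_def mult.assoc)
  qed
  have P: "P = (\<lambda>x. \<Prod>i\<in>UNIV. f i x)" by (simp add: P_def box_bump_def f_def fun_eq_iff)
  define P' where "P' = (\<lambda>x::real^'n. \<chi> i. f' i x * (\<Prod>j\<in>UNIV - {i}. f j x))"
  have dP: "(P has_derivative (\<lambda>h. P' x \<bullet> h)) (at x)" for x
    unfolding P
    by (rule has_derivative_eq_rhs, rule has_derivative_prod, rule df)
      (auto simp: P'_def inner_vec_def algebra_simps)
  define \<phi>' where "\<phi>' = (\<lambda>x. (k * exp (- k * P x)) *\<^sub>R P' x)"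
  have contf: "continuous_on UNIV (f i)" "continuous_on UNIV (f' i)" for i
    unfolding f_def f'_def by (intro continuous_intros)+
  have "continuous_on UNIV \<phi>'"
    unfolding \<phi>'_def P P'_def by (intro continuous_intros contf)
  moreover have "((\<lambda>x. 1 - exp (- k * P x)) has_derivative (\<lambda>h. \<phi>' x \<bullet> h)) (at x)" for x
    by (rule derivative_eq_intros dP refl | simp add: \<phi>'_def mult_ac)+
  moreover have supp: "{x. 1 - exp (- k * P x) \<noteq> 0} \<subseteq> cbox a b"
  proof
    fix x assume "x \<in> {x. 1 - exp (- k * P x) \<noteq> 0}"
    then have "P x \<noteq> 0" by auto
    then show "x \<in> cbox a b"
      using box_bump_eq_0_iff[OF ab] box_subset_cbox unfolding P_def by blast
  qed
  then have cl: "closure {x. 1 - exp (- k * P x) \<noteq> 0} \<subseteq> cbox a b"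
    by (rule closure_minimal) (rule closed_cbox)
  ultimately show ?thesis
    unfolding test_fun_def P_def[symmetric] compact_closure
    using sub cl bounded_subset[OF bounded_cbox supp] by blast
qed

text \<open>The test functions \<open>1 - exp (- k * box_bump a b x)\<close> tend pointwise to the
  indicator of the open box and are bounded by 1, so \<open>\<bar>f\<bar>\<close> on
  \<open>D\<close> dominates.\<close>

lemma set_lebesgue_integral_box_eq_0:
  fixes f :: "real^'n \<Rightarrow> real"
  assumes f: "set_integrable lebesgue D f"
    and D: "D \<in> sets lebesgue"
    and test: "\<And>\<phi> \<phi>'. test_fun D \<phi> \<phi>' \<Longrightarrow> (LINT x:D|lebesgue. f x * \<phi> x) = 0"
    and sub: "cbox a b \<subseteq> D"
  shows "(LINT x:box a b|lebesgue. f x) = 0"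
\<comment> \<open>Reversed bounds are treated apart: the factor of the bump for such a coordinate
  would be positive between the two bounds, although the box is empty.\<close>
proof (cases "\<forall>i. a $ i < b $ i")
  case False
  then have "box a b = {}" by (auto simp: interval_eq_empty_cart not_less)
  then show ?thesis by (simp add: set_lebesgue_integral_def)
next
  case True
  define P where "P = box_bump a b"
  define \<phi> where "\<phi> = (\<lambda>(n::nat) x. 1 - exp (- real (Suc n) * P x))"
  have P0: "P x \<ge> 0" for x by (simp add: P_def box_bump_nonneg)
  have Ppos: "P x > 0 \<longleftrightarrow> x \<in> box a b" for x
    using box_bump_eq_0_iff[of a b x] box_bump_nonneg[of a b x] True unfolding P_def by auto
  have [measurable]: "P \<in> borel_measurable lebesgue"
    unfolding P_def box_bump_def by (intro measurable_completion) measurable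
  have fm[measurable]: "(\<lambda>x. indicator D x * f x) \<in> borel_measurable lebesgue"
    using f by (auto simp: set_integrable_def)
  have lim: "(\<lambda>n. LINT x|lebesgue. indicator D x * f x * \<phi> n x) \<longlonglongrightarrow>
      (LINT x|lebesgue. indicator (box a b) x * f x)"
  proof (rule integral_dominated_convergence[where w="\<lambda>x. \<bar>indicator D x * f x\<bar>"])
    show "integrable lebesgue (\<lambda>x. \<bar>indicator D x * f x\<bar>)"
      using f by (auto simp: set_integrable_def)
    show "AE x in lebesgue. (\<lambda>n. indicator D x * f x * \<phi> n x) \<longlonglongrightarrow> indicator (box a b) x * f x"
    proof (intro AE_I2)
      fix x
      show "(\<lambda>n. indicator D x * f x * \<phi> n x) \<longlonglongrightarrow> indicator (box a b) x * f x"
      proof (cases "x \<in> box a b")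
        case True
        then have xD: "x \<in> D" using sub box_subset_cbox by blast
        have "(\<lambda>n. exp (- (P x)) ^ Suc n) \<longlonglongrightarrow> 0"
          using True Ppos[of x] by (intro LIMSEQ_Suc LIMSEQ_power_zero) auto
        then have "(\<lambda>n. exp (- real (Suc n) * P x)) \<longlonglongrightarrow> 0"
          by (simp only: exp_of_nat_mult[symmetric] mult_minus_left mult_minus_right)
        then have "(\<lambda>n. f x * (1 - exp (- real (Suc n) * P x))) \<longlonglongrightarrow> f x * (1 - 0)"
          by (intro tendsto_intros)
        then show ?thesis using True xD by (simp add: \<phi>_def)
      next
        case False
        then have "P x = 0" using Ppos[of x] P0[of x] by auto
        then show ?thesis using False by (simp add: \<phi>_def)
      qed
    qed
    show "AE x in lebesgue. norm (indicator D x * f x * \<phi> n x) \<le> \<bar>indicator D x * f x\<bar>" for n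
    proof (intro AE_I2)
      fix x
      have "exp (- real (Suc n) * P x) \<le> 1" using P0[of x] unfolding exp_le_one_iff by (intro mult_nonpos_nonneg) auto
      moreover have "exp (- real (Suc n) * P x) > 0" by (rule exp_gt_zero)
      ultimately have "\<bar>\<phi> n x\<bar> \<le> 1" unfolding \<phi>_def by linarith
      then show "norm (indicator D x * f x * \<phi> n x) \<le> \<bar>indicator D x * f x\<bar>"
        using mult_left_mono[of "\<bar>\<phi> n x\<bar>" 1 "\<bar>indicator D x * f x\<bar>"] by (simp add: abs_mult)
    qed
    show "(\<lambda>x. indicator (box a b) x * f x) \<in> borel_measurable lebesgue"
    proof -
      have "(\<lambda>x. indicator (box a b) x * f x) = (\<lambda>x. indicator (box a b) x * (indicator D x * f x))"
        using sub box_subset_cbox[of a b] by (auto simp: indicator_def fun_eq_iff)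
      moreover have "(\<lambda>x. indicator (box a b) x * (indicator D x * f x)) \<in> borel_measurable lebesgue"
        by (intro borel_measurable_times borel_measurable_indicator fm) simp
      ultimately show ?thesis by simp
    qed
    show "(\<lambda>x. indicator D x * f x * \<phi> n x) \<in> borel_measurable lebesgue" for n
      unfolding \<phi>_def by measurable
  qed
  have "(LINT x|lebesgue. indicator D x * f x * \<phi> n x) = 0" for n
  proof -
    obtain \<phi>' where "test_fun D (\<phi> n) \<phi>'"
      using box_bump_test_fun[of a b D "real (Suc n)"] True sub unfolding \<phi>_def P_def by auto
    from test[OF this] show ?thesis by (simp add: set_lebesgue_integral_def mult.assoc)
  qed
  with lim have "(LINT x|lebesgue. indicator (box a b) x * f x) = 0"
    by (simp add: LIMSEQ_const_iff)
  then show ?thesis by (simp add: set_lebesgue_integral_def)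
qed

text \<open>Open boxes form an intersection-stable generator of the Borel sets, so a Dynkin argument
  extends the vanishing from boxes to all Borel sets. The whole space is not a box; its integral is
  a separate assumption, used for complements.\<close>

lemma AE_eq_0_of_box_integrals:
  fixes f :: "'a::euclidean_space \<Rightarrow> real"
  assumes f: "integrable lborel f"
    and bx: "\<And>c d. (LINT x:box c d|lborel. f x) = 0"
    and total: "(LINT x|lborel. f x) = 0"
  shows "AE x in lborel. f x = 0"
proof (rule density_unique_real[OF f])
  show "integrable lborel (\<lambda>x::'a. 0::real)" by simp
  fix E :: "'a set" assume "E \<in> sets lborel"
  then have E: "E \<in> sigma_sets UNIV (range (\<lambda>(a, b). box a b))"
    by (simp add: borel_eq_box)
  have Pow_UNIV_sub: "range (\<lambda>(a, b). box a b :: 'a set) \<subseteq> Pow UNIV" by simp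
  have "Int_stable (range (\<lambda>(a, b). box a b :: 'a set))"
    by (auto simp: Int_stable_def box_Int_box)
  then have "(LINT x:E|lborel. f x) = 0"
    using Pow_UNIV_sub E
  proof (induction rule: sigma_sets_induct_disjoint)
    case (basic A) then show ?case using bx by auto
  next
    case empty show ?case by (simp add: set_lebesgue_integral_def)
  next
    case (compl A)
    then have [measurable]: "A \<in> sets borel" by (simp add: borel_eq_box)
    have int: "set_integrable lborel A f" "set_integrable lborel (- A) f"
      unfolding set_integrable_def by (auto intro!: integrable_mult_indicator[OF _ f] simp del: real_scaleR_def)
    have "(LINT x:A \<union> - A|lborel. f x) = (LINT x:A|lborel. f x) + (LINT x:- A|lborel. f x)"
      by (intro set_integral_Un int) auto
    then show ?case using compl total by (simp add: Compl_eq_Diff_UNIV set_lebesgue_integral_def)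
  next
    case (union A)
    then have [measurable]: "A i \<in> sets borel" for i by (auto simp: borel_eq_box)
    have "set_integrable lborel (\<Union>i. A i) f"
      unfolding set_integrable_def by (auto intro!: integrable_mult_indicator[OF _ f] simp del: real_scaleR_def)
    then have "(LINT x:(\<Union>i. A i)|lborel. f x) = (\<Sum>i. LINT x:A i|lborel. f x)"
      using union by (intro lebesgue_integral_countable_add) (auto simp: disjoint_family_on_def)
    then show ?case using union by simp
  qed
  then show "(LINT x:E|lborel. f x) = (LINT x:E|lborel. 0)" by (simp add: set_lebesgue_integral_def)
qed

text \<open>The box criterion needs a function on the whole space, so \<open>f\<close> is cut off to
  an open box whose closed box lies in \<open>D\<close>. Intersections of boxes are boxes, which
  reduces all integrals of the cut-off function to the preceding lemma on boxes. Countably many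
  closed boxes exhaust \<open>D\<close>.\<close>

lemma AE_eq_0_of_test_funs:
  fixes f :: "real^'n \<Rightarrow> real"
  assumes D: "open D" and [measurable]: "f \<in> borel_measurable borel"
    and f: "set_integrable lebesgue D f"
    and test: "\<And>\<phi> \<phi>'. test_fun D \<phi> \<phi>' \<Longrightarrow> (LINT x:D|lebesgue. f x * \<phi> x) = 0"
  shows "AE x in lborel. x \<in> D \<longrightarrow> f x = 0"
proof -
  have Ds: "D \<in> sets lebesgue" using D by auto
  obtain \<D> where \<D>: "countable \<D>" "\<Union>\<D> = D" "\<And>X. X \<in> \<D> \<Longrightarrow> \<exists>a b. X = cbox a b"
    using open_countable_Union_open_cbox[OF D] by metis
  have *: "AE x in lborel. x \<in> box a b \<longrightarrow> f x = 0" if sub: "cbox a b \<subseteq> D" for a b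
  proof -
    have int: "integrable lborel (\<lambda>x. indicator (box a b) x * f x)"
    proof -
      have "set_integrable lebesgue (box a b) f"
        using f sub box_subset_cbox[of a b] by (intro set_integrable_subset[OF f]) auto
      then show ?thesis
        by (simp add: set_integrable_def integrable_completion)
    qed
    have z: "(LINT x:box c d|lborel. indicator (box a b) x * f x) = 0" for c d
    proof -
      obtain c' d' where cd: "box a b \<inter> box c d = box c' d'"
        using box_Int_box[of a b c d] by blast
      \<comment> \<open>An empty box may have arbitrary corners, so nothing is known about
        \<open>cbox c' d'\<close> then. A nonempty box has \<open>cbox c' d'\<close> as its closure,
        which stays inside \<open>cbox a b\<close>.\<close>
      have "box c' d' = {} \<or> cbox c' d' \<subseteq> D"
      proof (rule disjCI)
        assume "\<not> cbox c' d' \<subseteq> D"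
        moreover have "closure (box c' d') \<subseteq> cbox a b"
          using cd box_subset_cbox[of a b] by (intro closure_minimal) auto
        ultimately show "box c' d' = {}" using sub by (metis closure_box order_trans)
      qed
      then have "(LINT x:box c' d'|lebesgue. f x) = 0"
      proof
        assume "cbox c' d' \<subseteq> D"
        with test show ?thesis by (intro set_lebesgue_integral_box_eq_0[OF f Ds])
      qed (simp add: set_lebesgue_integral_def)
      then have "(LINT x:box c' d'|lborel. f x) = 0"
        by (simp add: set_lebesgue_integral_def integral_completion)
      then show ?thesis
        unfolding cd[symmetric] set_lebesgue_integral_def indicator_inter_arith real_scaleR_def
        by (simp only: mult_ac)
    qed
    have t: "(LINT x|lborel. indicator (box a b) x * f x) = 0"
      using z[of a b] unfolding set_lebesgue_integral_def indicator_inter_arith real_scaleR_def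
        mult.assoc[symmetric] indicator_inter_arith[symmetric] Int_absorb .
    have "AE x in lborel. indicator (box a b) x * f x = 0"
      by (rule AE_eq_0_of_box_integrals[OF int z t])
    then show ?thesis by eventually_elim (auto simp: indicator_def)
  qed
  have "AE x in lborel. x \<in> X \<longrightarrow> f x = 0" if "X \<in> \<D>" for X
  proof -
    obtain a b where X: "X = cbox a b" "cbox a b \<subseteq> D" using \<D> \<open>X \<in> \<D>\<close> by blast
    have "AE x in lborel. x \<notin> cbox a b - box a b"
      by (intro AE_not_in null_sets_cbox_Diff_box)
    with *[OF X(2)] show ?thesis unfolding X by eventually_elim auto
  qed
  then have "AE x in lborel. \<forall>X\<in>\<D>. x \<in> X \<longrightarrow> f x = 0"
    by (subst AE_ball_countable[OF \<D>(1)]) blast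
  then show ?thesis using \<D>(2) by (auto elim!: eventually_mono)
qed

subsection \<open>Weak gradients\<close>

lemma sq_int_on_lebesgue_on:
  assumes "D \<in> sets lebesgue"
  shows "sq_int_on D f \<longleftrightarrow> f \<in> borel_measurable (lebesgue_on D) \<and> integrable (lebesgue_on D) (\<lambda>x. (f x)\<^sup>2)"
  using assms by (auto simp: sq_int_on_def integrable_restrict_space set_integrable_def)

lemma sq_int_on_lincomb:
  assumes D: "D \<in> sets lebesgue" and f: "sq_int_on D f" and g: "sq_int_on D g"
  shows "sq_int_on D (\<lambda>x. a * f x + b * g x)"
proof -
  have [measurable]: "f \<in> borel_measurable (lebesgue_on D)" "g \<in> borel_measurable (lebesgue_on D)"
    and int: "integrable (lebesgue_on D) (\<lambda>x. (f x)\<^sup>2)" "integrable (lebesgue_on D) (\<lambda>x. (g x)\<^sup>2)"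
    using f g D by (auto simp: sq_int_on_lebesgue_on)
  have "integrable (lebesgue_on D) (\<lambda>x. (a * f x + b * g x)\<^sup>2)"
  proof (rule Bochner_Integration.integrable_bound)
    show "integrable (lebesgue_on D) (\<lambda>x. 2 * a\<^sup>2 * (f x)\<^sup>2 + 2 * b\<^sup>2 * (g x)\<^sup>2)"
      using int by simp
    have "(a * y + b * z)\<^sup>2 \<le> 2 * a\<^sup>2 * y\<^sup>2 + 2 * b\<^sup>2 * z\<^sup>2" for y z :: real
      using zero_le_power2[of "a * y - b * z"] by (simp add: power2_eq_square algebra_simps)
    then show "AE x in lebesgue_on D. norm ((a * f x + b * g x)\<^sup>2) \<le> norm (2 * a\<^sup>2 * (f x)\<^sup>2 + 2 * b\<^sup>2 * (g x)\<^sup>2)"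
      by (intro AE_I2) (simp add: abs_of_nonneg)
  qed measurable
  then show ?thesis using D by (simp add: sq_int_on_lebesgue_on)
qed

text \<open>On a bounded set the bound \<open>\<bar>f x\<bar> \<le> 1 + (f x)\<^sup>2\<close> turns
  square integrability into integrability, and \<open>\<phi>\<close> is bounded on the compact
  closure of \<open>D\<close>. The choice of the constant 1 for \<open>\<phi>\<close> gives
  integrability of \<open>f\<close> itself.\<close>

lemma sq_int_on_mult_continuous:
  assumes D: "open D" "bounded D" and f: "sq_int_on D f" and \<phi>: "continuous_on UNIV (\<phi> :: real^'n \<Rightarrow> real)"
  shows "set_integrable lebesgue D (\<lambda>x. f x * \<phi> x)"
proof -
  have Ds: "D \<in> sets lebesgue" using D by auto
  have [measurable]: "f \<in> borel_measurable (lebesgue_on D)" "\<phi> \<in> borel_measurable (lebesgue_on D)"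
    and int: "integrable (lebesgue_on D) (\<lambda>x. (f x)\<^sup>2)"
    using f Ds \<phi> by (auto simp: sq_int_on_lebesgue_on intro!: measurable_restrict_space1 measurable_completion
        borel_measurable_continuous_onI)
  have "compact (\<phi> ` closure D)"
    using D \<phi> by (intro compact_continuous_image) (auto simp: compact_closure intro: continuous_on_subset)
  then obtain C where C: "\<And>x. x \<in> D \<Longrightarrow> \<bar>\<phi> x\<bar> \<le> C"
    using closure_subset[of D] by (force simp: bounded_iff dest!: compact_imp_bounded)
  interpret finite_measure "lebesgue_on D"
    using D by (intro finite_measure_lebesgue_on bounded_set_imp_lmeasurable) auto
  have "integrable (lebesgue_on D) (\<lambda>x. f x * \<phi> x)"
  proof (rule Bochner_Integration.integrable_bound)
    show "integrable (lebesgue_on D) (\<lambda>x. C * (1 + (f x)\<^sup>2))"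
      using int by simp
    show "AE x in lebesgue_on D. norm (f x * \<phi> x) \<le> norm (C * (1 + (f x)\<^sup>2))"
    proof (intro AE_I2)
      fix x assume "x \<in> space (lebesgue_on D)"
      then have c: "\<bar>\<phi> x\<bar> \<le> C" using C by simp
      have "\<bar>f x\<bar> \<le> 1 + (f x)\<^sup>2"
        using zero_le_power2[of "\<bar>f x\<bar> - 1"] by (simp add: power2_eq_square algebra_simps)
      then have "\<bar>\<phi> x\<bar> * \<bar>f x\<bar> \<le> \<bar>C\<bar> * (1 + (f x)\<^sup>2)"
        using c by (intro mult_mono) auto
      then show "norm (f x * \<phi> x) \<le> norm (C * (1 + (f x)\<^sup>2))"
        by (simp add: abs_mult mult.commute)
    qed
  qed measurable
  then show ?thesis using Ds by (simp add: integrable_restrict_space set_integrable_def)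
qed

lemma test_fun_continuous:
  assumes "test_fun D \<phi> \<phi>'"
  shows "continuous_on UNIV \<phi>" "continuous_on UNIV (\<lambda>x. \<phi>' x $ i)"
proof -
  show "continuous_on UNIV \<phi>"
    using assms unfolding test_fun_def
    by (intro continuous_at_imp_continuous_on ballI) (blast intro: has_derivative_continuous)
  show "continuous_on UNIV (\<lambda>x. \<phi>' x $ i)"
    using assms unfolding test_fun_def by (intro continuous_intros) auto
qed

lemma has_weak_gradient_lincomb:
  fixes D :: "(real^'n) set"
  assumes D: "open D" "bounded D"
    and u: "has_weak_gradient D u g" and v: "has_weak_gradient D v h"
  shows "has_weak_gradient D (\<lambda>x. a * u x + b * v x) (\<lambda>x. a *\<^sub>R g x + b *\<^sub>R h x)"
proof -
  have Ds: "D \<in> sets lebesgue" using D by auto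
  have "(LINT x:D|lebesgue. (a * u x + b * v x) * \<phi>' x $ i) =
      - (LINT x:D|lebesgue. (a *\<^sub>R g x + b *\<^sub>R h x) $ i * \<phi> x)" if t: "test_fun D \<phi> \<phi>'" for \<phi> \<phi>' i
  proof -
    note int = sq_int_on_mult_continuous[OF D _ test_fun_continuous(1)[OF t]]
      sq_int_on_mult_continuous[OF D _ test_fun_continuous(2)[OF t, of i]]
    have "(LINT x:D|lebesgue. (a * u x + b * v x) * \<phi>' x $ i) =
        (LINT x:D|lebesgue. a * (u x * \<phi>' x $ i) + b * (v x * \<phi>' x $ i))"
      by (simp add: algebra_simps)
    also have "\<dots> = a * (LINT x:D|lebesgue. u x * \<phi>' x $ i) + b * (LINT x:D|lebesgue. v x * \<phi>' x $ i)"
      using u v int by (subst set_integral_add) (auto simp: has_weak_gradient_def)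
    also have "\<dots> = - (a * (LINT x:D|lebesgue. g x $ i * \<phi> x) + b * (LINT x:D|lebesgue. h x $ i * \<phi> x))"
      using u v t by (auto simp: has_weak_gradient_def)
    also have "a * (LINT x:D|lebesgue. g x $ i * \<phi> x) + b * (LINT x:D|lebesgue. h x $ i * \<phi> x) =
        (LINT x:D|lebesgue. a * (g x $ i * \<phi> x) + b * (h x $ i * \<phi> x))"
      using u v int by (subst set_integral_add) (auto simp: has_weak_gradient_def)
    also have "\<dots> = (LINT x:D|lebesgue. (a *\<^sub>R g x + b *\<^sub>R h x) $ i * \<phi> x)"
      by (simp add: algebra_simps)
    finally show ?thesis .
  qed
  then show ?thesis
    using u v sq_int_on_lincomb[OF Ds] by (auto simp: has_weak_gradient_def)
qed

text \<open>Each component of the difference integrates to zero against every test function. The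
  Borel assumptions, which sections of jointly measurable fields satisfy, allow a conclusion in
  \<open>lborel\<close>.\<close>

lemma has_weak_gradient_unique:
  fixes D :: "(real^'n) set"
  assumes D: "open D" "bounded D"
    and g: "has_weak_gradient D v g" "g \<in> borel_measurable borel"
    and h: "has_weak_gradient D v h" "h \<in> borel_measurable borel"
  shows "AE x in lborel. x \<in> D \<longrightarrow> g x = h x"
proof -
  have "AE x in lborel. x \<in> D \<longrightarrow> g x $ i - h x $ i = 0" for i
  proof (rule AE_eq_0_of_test_funs[OF D(1)])
    have sq: "sq_int_on D (\<lambda>x. g x $ i)" "sq_int_on D (\<lambda>x. h x $ i)"
      using g h by (auto simp: has_weak_gradient_def)
    have "(\<lambda>x. k x $ i) \<in> borel_measurable borel" if "k \<in> borel_measurable borel" for k :: "real^'n \<Rightarrow> real^'n"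
      by (rule borel_measurable_continuous_on[OF _ that]) (intro continuous_intros)
    then show "(\<lambda>x. g x $ i - h x $ i) \<in> borel_measurable borel"
      using g(2) h(2) by (intro borel_measurable_diff)
    show "set_integrable lebesgue D (\<lambda>x. g x $ i - h x $ i)"
      using set_integral_diff(1)[OF sq_int_on_mult_continuous[OF D sq(1), of "\<lambda>_. 1"]
          sq_int_on_mult_continuous[OF D sq(2), of "\<lambda>_. 1"]] by simp
    fix \<phi> \<phi>' assume t: "test_fun D \<phi> \<phi>'"
    have "(LINT x:D|lebesgue. g x $ i * \<phi> x - h x $ i * \<phi> x) =
        (LINT x:D|lebesgue. g x $ i * \<phi> x) - (LINT x:D|lebesgue. h x $ i * \<phi> x)"
      using test_fun_continuous(1)[OF t] by (intro set_integral_diff(2) sq_int_on_mult_continuous D sq)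
    also have "\<dots> = 0"
    proof -
      have "(LINT x:D|lebesgue. v x * \<phi>' x $ i) = - (LINT x:D|lebesgue. g x $ i * \<phi> x)"
        using g(1) t unfolding has_weak_gradient_def by blast
      moreover have "(LINT x:D|lebesgue. v x * \<phi>' x $ i) = - (LINT x:D|lebesgue. h x $ i * \<phi> x)"
        using h(1) t unfolding has_weak_gradient_def by blast
      ultimately show ?thesis by simp
    qed
    finally show "(LINT x:D|lebesgue. (g x $ i - h x $ i) * \<phi> x) = 0"
      by (simp add: left_diff_distrib)
  qed
  then have "AE x in lborel. \<forall>i\<in>UNIV. x \<in> D \<longrightarrow> g x $ i - h x $ i = 0"
    by (intro AE_finite_allI) auto
  then show ?thesis by eventually_elim (auto simp: vec_eq_iff)
qed

lemma is_rgrad_lc: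
  fixes D :: "(real^'n) set"
  assumes D: "open D" "bounded D" and u: "is_rgrad M D u G" and v: "is_rgrad M D v H"
  shows "is_rgrad M D (lc a u b v) (\<lambda>\<omega> x. a *\<^sub>R G \<omega> x + b *\<^sub>R H \<omega> x)"
  unfolding is_rgrad_def
proof
  have "(\<lambda>p. G (fst p) (snd p)) \<in> borel_measurable (M \<Otimes>\<^sub>M lborel)"
    "(\<lambda>p. H (fst p) (snd p)) \<in> borel_measurable (M \<Otimes>\<^sub>M lborel)"
    using u v by (auto simp: is_rgrad_def split_beta)
  then show "(\<lambda>(\<omega>, x). a *\<^sub>R G \<omega> x + b *\<^sub>R H \<omega> x) \<in> borel_measurable (M \<Otimes>\<^sub>M lborel)"
    unfolding split_beta by (intro borel_measurable_add borel_measurable_scaleR borel_measurable_const)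
  have "AE \<omega> in M. has_weak_gradient D (u \<omega>) (G \<omega>)" "AE \<omega> in M. has_weak_gradient D (v \<omega>) (H \<omega>)"
    using u v by (auto simp: is_rgrad_def)
  then show "AE \<omega> in M. has_weak_gradient D (lc a u b v \<omega>) (\<lambda>x. a *\<^sub>R G \<omega> x + b *\<^sub>R H \<omega> x)"
    by eventually_elim (simp add: lc_def has_weak_gradient_lincomb[OF D])
qed

lemma is_rgrad_section_measurable:
  assumes "is_rgrad M D v G" "\<omega> \<in> space M"
  shows "G \<omega> \<in> borel_measurable borel"
proof -
  have "(\<lambda>(\<omega>, x). G \<omega> x) \<in> borel_measurable (M \<Otimes>\<^sub>M lborel)"
    using assms(1) by (simp add: is_rgrad_def)
  from measurable_Pair2[OF this assms(2)] show ?thesis by simp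
qed

lemma is_rgrad_rgrad: "is_rgrad M D v G \<Longrightarrow> is_rgrad M D v (rgrad M D v)"
  unfolding rgrad_def by (rule someI[of "is_rgrad M D v"])

lemma is_rgrad_unique:
  fixes D :: "(real^'n) set"
  assumes D: "open D" "bounded D" and "is_rgrad M D v G" and "is_rgrad M D v H"
  shows "AE \<omega> in M. AE x in lborel. x \<in> D \<longrightarrow> G \<omega> x = H \<omega> x"
proof -
  have "AE \<omega> in M. has_weak_gradient D (v \<omega>) (G \<omega>)" "AE \<omega> in M. has_weak_gradient D (v \<omega>) (H \<omega>)"
    using assms by (auto simp: is_rgrad_def)
  with AE_space show ?thesis
    by eventually_elim
      (intro has_weak_gradient_unique[OF D] is_rgrad_section_measurable[OF assms(3)]
        is_rgrad_section_measurable[OF assms(4)])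
qed

subsection \<open>Symmetric and elliptic matrices\<close>

lemma inner_symmetric_matrix:
  fixes K :: "real^'n^'n"
  assumes "transpose K = K"
  shows "(K *v x) \<bullet> y = x \<bullet> (K *v y)"
  by (metis assms dot_lmul_matrix vector_transpose_matrix)

text \<open>A crude bound through the sum of the components; for \<open>A0\<close> only some finite
  constant is wanted.\<close>

lemma norm_matrix_vector_mult_le:
  fixes K :: "real^'n^'m"
  shows "norm (K *v x) \<le> real CARD('m) * norm K * norm x"
proof -
  have "norm (K *v x) \<le> (\<Sum>i\<in>UNIV. \<bar>(K *v x) $ i\<bar>)"
    by (rule norm_le_l1_cart)
  also have "\<dots> \<le> (\<Sum>i\<in>(UNIV::'m set). norm K * norm x)"
  proof (rule sum_mono)
    fix i
    have "\<bar>(K *v x) $ i\<bar> \<le> norm (K $ i) * norm x"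
      by (simp add: matrix_vector_mul_component Cauchy_Schwarz_ineq2)
    also have "\<dots> \<le> norm K * norm x"
      by (intro mult_right_mono Finite_Cartesian_Product.norm_nth_le norm_ge_zero)
    finally show "\<bar>(K *v x) $ i\<bar> \<le> norm K * norm x" .
  qed
  finally show ?thesis by simp
qed

text \<open>Polarisation: testing the form against a multiple of \<open>K *v x\<close> with the norm of \<open>x\<close>
  bounds the operator norm by the upper bound of the quadratic form.\<close>

lemma norm_symmetric_matrix_le:
  fixes K :: "real^'n^'n"
  assumes sym: "transpose K = K" and pos: "\<And>a. 0 \<le> a \<bullet> (K *v a)"
    and le: "\<And>a. a \<bullet> (K *v a) \<le> c * (norm a)\<^sup>2"
  shows "norm (K *v x) \<le> c * norm x"
proof (cases "K *v x = 0 \<or> x = 0")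
  case True
  show ?thesis
  proof (cases "x = 0")
    case False
    have "0 \<le> c * (norm x)\<^sup>2" using pos[of x] le[of x] by linarith
    then have "0 \<le> c" using False by (simp add: zero_le_mult_iff)
    then show ?thesis using True False by simp
  qed simp
next
  case False
  define y where "y = (norm x / norm (K *v x)) *\<^sub>R (K *v x)"
  have ny: "norm y = norm x" using False by (simp add: y_def)
  have "4 * (y \<bullet> (K *v x)) = (y + x) \<bullet> (K *v (y + x)) - (y - x) \<bullet> (K *v (y - x))"
    using inner_symmetric_matrix[OF sym, of x y]
    by (simp add: algebra_simps inner_commute matrix_vector_right_distrib)
  also have "\<dots> \<le> c * (norm (y + x))\<^sup>2" using le[of "y + x"] pos[of "y - x"] by linarith
  also have "\<dots> \<le> c * (2 * norm x)\<^sup>2"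
  proof (rule mult_left_mono)
    show "(norm (y + x))\<^sup>2 \<le> (2 * norm x)\<^sup>2"
      using norm_triangle_ineq[of y x] ny by (intro power_mono) auto
    have "0 \<le> c * (norm x)\<^sup>2" using pos[of x] le[of x] by linarith
    then show "0 \<le> c" using False by (simp add: zero_le_mult_iff)
  qed
  finally have "y \<bullet> (K *v x) \<le> c * (norm x)\<^sup>2" by (simp add: power2_eq_square)
  moreover have "y \<bullet> (K *v x) = norm x * norm (K *v x)"
    using False by (simp add: y_def dot_square_norm power2_eq_square)
  ultimately show ?thesis using False by (simp add: power2_eq_square)
qed

text \<open>Cramer's formula solves \<open>K *v x = y\<close> by an expression that is visibly Borel in \<open>K\<close> and \<open>y\<close>;
  it is a junk value if \<open>det K = 0\<close>.\<close>

definition cramer_solve :: "real^'n^'n \<Rightarrow> real^'n \<Rightarrow> real^'n" where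
  "cramer_solve K y = (\<chi> k. det (\<chi> i j. if j = k then y $ i else K $ i $ j) / det K)"

lemma cramer_solve:
  assumes "invertible K"
  shows "K *v cramer_solve K y = y"
  using assms cramer[of K "cramer_solve K y" y] by (simp add: cramer_solve_def invertible_det_nz)

lemma cramer_solve_unique:
  assumes "invertible K" "K *v x = y"
  shows "x = cramer_solve K y"
  using assms cramer[of K x y] by (simp add: cramer_solve_def invertible_det_nz)

lemma borel_measurable_vec_nth:
  "f \<in> borel_measurable N \<Longrightarrow> (\<lambda>x. f x $ i :: 'b::euclidean_space) \<in> borel_measurable N"
  by (rule borel_measurable_continuous_on[of "\<lambda>x. x $ i"]) (intro continuous_intros)

lemma borel_measurable_det:
  fixes K :: "'a \<Rightarrow> real^'n^'n"
  assumes "\<And>i j. (\<lambda>p. K p $ i $ j) \<in> borel_measurable N"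
  shows "(\<lambda>p. det (K p)) \<in> borel_measurable N"
  unfolding det_def by (intro borel_measurable_sum borel_measurable_times borel_measurable_prod assms borel_measurable_const)

lemma borel_measurable_vec_lambda:
  fixes f :: "'a \<Rightarrow> 'n::finite \<Rightarrow> real"
  assumes "\<And>i. (\<lambda>p. f p i) \<in> borel_measurable N"
  shows "(\<lambda>p. \<chi> i. f p i) \<in> borel_measurable N"
proof (rule borel_measurable_euclidean_space[THEN iffD2], rule ballI)
  fix b :: "real^'n" assume "b \<in> Basis"
  then obtain i where "b = axis i 1" by (auto simp: Basis_vec_def)
  then show "(\<lambda>p. (\<chi> i. f p i) \<bullet> b) \<in> borel_measurable N"
    using assms[of i] by (simp add: inner_axis)
qed

lemma borel_measurable_cramer_solve:
  assumes K: "K \<in> borel_measurable N" and y: "y \<in> borel_measurable N"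
  shows "(\<lambda>p. cramer_solve (K p) (y p)) \<in> borel_measurable N"
proof -
  have "(\<lambda>p. (\<chi> i j. if j = k then y p $ i else K p $ i $ j) $ i $ j) \<in> borel_measurable N" for k i j
    by (cases "j = k") (simp_all add: borel_measurable_vec_nth K y)
  then have "(\<lambda>p. det (\<chi> i j. if j = k then y p $ i else K p $ i $ j)) \<in> borel_measurable N" for k
    by (rule borel_measurable_det)
  moreover have "(\<lambda>p. det (K p)) \<in> borel_measurable N"
    by (intro borel_measurable_det borel_measurable_vec_nth K)
  ultimately show ?thesis
    unfolding cramer_solve_def by (intro borel_measurable_vec_lambda borel_measurable_divide)
qed

lemma borel_measurable_matrix_vector_mult:
  fixes K :: "'a \<Rightarrow> real^'n^'m"
  assumes K: "K \<in> borel_measurable N" and y: "y \<in> borel_measurable N"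
  shows "(\<lambda>p. K p *v y p) \<in> borel_measurable N"
  unfolding matrix_vector_mult_def
  by (intro borel_measurable_vec_lambda borel_measurable_sum borel_measurable_times borel_measurable_vec_nth K y)

lemma elliptic_matrix_invertible:
  fixes K :: "real^'n^'n"
  assumes "0 < c" and "\<And>a. c * (norm a)\<^sup>2 \<le> a \<bullet> (K *v a)"
  shows "invertible K"
  unfolding invertible_left_inverse matrix_left_invertible_ker
proof (intro allI impI)
  fix x assume "K *v x = 0"
  then have "c * (norm x)\<^sup>2 \<le> 0" using assms(2)[of x] by simp
  then show "x = 0" using assms(1) by (simp add: mult_le_0_iff)
qed

text \<open>The usual a priori estimate: the equation is tested with its own solution. It is what
  keeps \<open>defect X\<close> square integrable.\<close>

lemma elliptic_cramer_solve_norm_le: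
  fixes K :: "real^'n^'n"
  assumes c: "0 < c" and ell: "\<And>a. c * (norm a)\<^sup>2 \<le> a \<bullet> (K *v a)"
  shows "norm (cramer_solve K y) \<le> norm y / c"
proof -
  let ?x = "cramer_solve K y"
  have "c * (norm ?x)\<^sup>2 \<le> ?x \<bullet> y"
    using ell[of ?x] cramer_solve[OF elliptic_matrix_invertible[OF c ell]] by simp
  also have "\<dots> \<le> norm ?x * norm y" by (rule norm_cauchy_schwarz)
  finally have "norm ?x * (c * norm ?x) \<le> norm ?x * norm y" by (simp add: power2_eq_square mult_ac)
  then have "c * norm ?x \<le> norm y" using norm_ge_zero[of y]
    by (cases "?x = 0") (auto simp: mult_le_cancel_left)
  then show ?thesis using c by (simp add: field_simps)
qed

text \<open>Multiplied by \<open>K\<close>, the left side becomes \<open>(K - K0) *v x\<close>. The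
  inverse, which is defined by choice, is thus traded for a formula of known measurability.\<close>

lemma matrix_inv_defect_eq_cramer_solve:
  fixes K K0 :: "real^'n^'n"
  assumes "invertible K"
  shows "(mat 1 - matrix_inv K ** K0) *v x = cramer_solve K ((K - K0) *v x)"
proof (rule cramer_solve_unique[OF assms])
  have "K *v ((mat 1 - matrix_inv K ** K0) *v x) = K *v x - (K ** matrix_inv K) *v (K0 *v x)"
    by (simp add: matrix_vector_mult_diff_rdistrib matrix_vector_mult_diff_distrib matrix_vector_mul_assoc matrix_mul_assoc)
  also have "K ** matrix_inv K = mat 1" 
    using someI_ex[OF assms[unfolded invertible_def]] by (simp add: matrix_inv_def)
  finally show "K *v ((mat 1 - matrix_inv K ** K0) *v x) = (K - K0) *v x"
    by (simp add: matrix_vector_mult_diff_rdistrib)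
qed

section \<open>Almost everywhere equality in complete measure spaces\<close>

lemma (in complete_measure) borel_measurable_cong_AE_complete:
  assumes g: "g \<in> M \<rightarrow>\<^sub>M N" and f: "\<And>x. x \<in> space M \<Longrightarrow> f x \<in> space N" and ae: "AE x in M. f x = g x"
  shows "f \<in> M \<rightarrow>\<^sub>M N"
proof (rule measurableI)
  fix E assume "E \<in> sets N"
  then have sets: "g -` E \<inter> space M \<in> sets M" by (rule measurable_sets[OF g])
  have "AE x in M. x \<in> g -` E \<inter> space M \<longleftrightarrow> x \<in> f -` E \<inter> space M"
    using ae by eventually_elim auto
  from in_sets_AE[OF this sets] show "f -` E \<inter> space M \<in> sets M" by simp
qed (rule f)

text \<open>Only \<open>g\<close> has to be known measurable; completeness passes this on to
  \<open>f\<close>. The integrands of \<open>Rres\<close> and \<open>Jform\<close> take the place of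
  \<open>f\<close> later.\<close>

lemma (in complete_measure) integral_cong_AE_complete:
  fixes f :: "'a \<Rightarrow> real"
  assumes "g \<in> borel_measurable M" "AE x in M. f x = g x"
  shows "integral\<^sup>L M f = integral\<^sup>L M g"
  using borel_measurable_cong_AE_complete[OF assms(1) _ assms(2)] assms by (intro integral_cong_AE) auto

lemma AE_lebesgue_on_iff:
  "D \<in> sets borel \<Longrightarrow> (AE x in lebesgue_on D. P x) \<longleftrightarrow> (AE x in lborel. x \<in> D \<longrightarrow> P x)"
  by (subst AE_restrict_space_iff) (auto simp: AE_completion_iff)

subsection \<open>Square integrable random fields\<close>

definition comb :: "real \<Rightarrow> ('w \<Rightarrow> 'x \<Rightarrow> 'v::real_vector) \<Rightarrow> real \<Rightarrow> ('w \<Rightarrow> 'x \<Rightarrow> 'v) \<Rightarrow> 'w \<Rightarrow> 'x \<Rightarrow> 'v" where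
  "comb a X b Y = (\<lambda>\<omega> x. a *\<^sub>R X \<omega> x + b *\<^sub>R Y \<omega> x)"

locale random_domain = prob_space M + complete_measure M
  for M :: "'w measure" +
  fixes D :: "(real^'n) set"
  assumes D: "open D" "bounded D"
begin

sublocale pair: pair_sigma_finite M "lborel :: (real^'n) measure" ..

lemma D_sets [simp]: "D \<in> sets borel" "D \<in> sets lebesgue"
  using D by auto

text \<open>The iterated form matches the hypotheses on the coefficients and makes sense for
  predicates that are not jointly measurable.\<close>

definition AE_D :: "('w \<Rightarrow> real^'n \<Rightarrow> bool) \<Rightarrow> bool" where
  "AE_D P \<longleftrightarrow> (AE \<omega> in M. AE x in lborel. x \<in> D \<longrightarrow> P \<omega> x)"

lemma AE_D_mp: "AE_D P \<Longrightarrow> (\<And>\<omega> x. P \<omega> x \<Longrightarrow> Q \<omega> x) \<Longrightarrow> AE_D Q"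
  unfolding AE_D_def by (auto elim!: eventually_mono)

lemma AE_D_conj: "AE_D P \<Longrightarrow> AE_D Q \<Longrightarrow> AE_D (\<lambda>\<omega> x. P \<omega> x \<and> Q \<omega> x)"
  unfolding AE_D_def by (elim eventually_elim2) (auto elim: eventually_elim2)

definition meas :: "('w \<Rightarrow> real^'n \<Rightarrow> 'v::topological_space) \<Rightarrow> bool" where
  "meas f \<longleftrightarrow> (\<lambda>p. f (fst p) (snd p)) \<in> borel_measurable (M \<Otimes>\<^sub>M lborel)"

text \<open>Integrability over the product, while \<open>EInt\<close> is iterated: Fubini then turns
  \<open>EInt\<close> into a single integral, which is linear.\<close>

definition int_D :: "('w \<Rightarrow> real^'n \<Rightarrow> real) \<Rightarrow> bool" where
  "int_D f \<longleftrightarrow> integrable (M \<Otimes>\<^sub>M lborel) (\<lambda>p. indicator D (snd p) * f (fst p) (snd p))"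

lemma indicator_snd_measurable [measurable]:
  "(\<lambda>p. indicator D (snd p) :: real) \<in> borel_measurable (M \<Otimes>\<^sub>M (lborel :: (real^'n) measure))"
  by (rule measurable_compose[OF measurable_snd borel_measurable_indicator]) simp

text \<open>An iterated statement passes to the product measure once its set is measurable. An
  inequality between two measurable functions, both cut off to \<open>D\<close>, describes such a
  set.\<close>

lemma AE_pair_D:
  assumes f: "meas f" and g: "meas g" and le: "AE_D (\<lambda>\<omega> x. f \<omega> x \<le> (g \<omega> x :: real))"
  shows "AE p in M \<Otimes>\<^sub>M lborel. snd p \<in> D \<longrightarrow> f (fst p) (snd p) \<le> g (fst p) (snd p)"
proof (rule pair.AE_pair_measure)
  show "AE \<omega> in M. AE x in lborel. snd (\<omega>, x) \<in> D \<longrightarrow> f (fst (\<omega>, x)) (snd (\<omega>, x)) \<le> g (fst (\<omega>, x)) (snd (\<omega>, x))"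
    using le by (simp add: AE_D_def)
  have m: "(\<lambda>p. indicator D (snd p) * f (fst p) (snd p)) \<in> borel_measurable (M \<Otimes>\<^sub>M lborel)"
    "(\<lambda>p. indicator D (snd p) * g (fst p) (snd p)) \<in> borel_measurable (M \<Otimes>\<^sub>M lborel)"
    using f g unfolding meas_def by (auto intro: borel_measurable_times indicator_snd_measurable)
  have "{p \<in> space (M \<Otimes>\<^sub>M lborel). snd p \<in> D \<longrightarrow> f (fst p) (snd p) \<le> g (fst p) (snd p)} =
      {p \<in> space (M \<Otimes>\<^sub>M lborel). indicator D (snd p) * f (fst p) (snd p) \<le> indicator D (snd p) * g (fst p) (snd p)}"
    by (auto simp: indicator_def)
  also have "\<dots> \<in> sets (M \<Otimes>\<^sub>M lborel)"
    by (rule borel_measurable_le[OF m])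
  finally show "{p \<in> space (M \<Otimes>\<^sub>M lborel). snd p \<in> D \<longrightarrow> f (fst p) (snd p) \<le> g (fst p) (snd p)} \<in> sets (M \<Otimes>\<^sub>M lborel)" .
qed

lemma int_D_bound:
  assumes f: "meas f" and g: "meas g" "int_D g" and le: "AE_D (\<lambda>\<omega> x. \<bar>f \<omega> x\<bar> \<le> g \<omega> x)"
  shows "int_D f"
  unfolding int_D_def
proof (rule Bochner_Integration.integrable_bound[OF g(2)[unfolded int_D_def]])
  have fm: "(\<lambda>p. f (fst p) (snd p)) \<in> borel_measurable (M \<Otimes>\<^sub>M lborel)"
    using f by (simp add: meas_def)
  then show "(\<lambda>p. indicator D (snd p) * f (fst p) (snd p)) \<in> borel_measurable (M \<Otimes>\<^sub>M lborel)"
    by (intro borel_measurable_times indicator_snd_measurable)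
  have "meas (\<lambda>\<omega> x. \<bar>f \<omega> x\<bar>)" using fm unfolding meas_def by measurable
  from AE_pair_D[OF this g(1) le]
  show "AE p in M \<Otimes>\<^sub>M lborel. norm (indicator D (snd p) * f (fst p) (snd p)) \<le> norm (indicator D (snd p) * g (fst p) (snd p))"
    by eventually_elim (auto simp: indicator_def)
qed

lemma int_D_lincomb: "int_D f \<Longrightarrow> int_D g \<Longrightarrow> int_D (\<lambda>\<omega> x. a * f \<omega> x + b * g \<omega> x)"
  unfolding int_D_def distrib_left mult.left_commute[of "indicator D _"]
  by (intro Bochner_Integration.integrable_add integrable_mult_right)

text \<open>\<open>EInt\<close> integrates in \<open>lebesgue\<close>, Fubini in
  \<open>lborel\<close>. Sections of a jointly measurable function are Borel, and for Borel
  integrands the two integrals agree.\<close>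

lemma inner_integral_lborel:
  assumes "int_D f" "\<omega> \<in> space M"
  shows "(\<lambda>x. indicator D x * f \<omega> x) \<in> borel_measurable borel"
    and "(LINT x:D|lebesgue. f \<omega> x) = (LINT x|lborel. indicator D x * f \<omega> x)"
proof -
  have "(\<lambda>p. indicator D (snd p) * f (fst p) (snd p)) \<in> borel_measurable (M \<Otimes>\<^sub>M lborel)"
    using assms(1) by (auto simp: int_D_def)
  from measurable_Pair2[OF this assms(2)]
  show *: "(\<lambda>x. indicator D x * f \<omega> x) \<in> borel_measurable borel" by simp
  then show "(LINT x:D|lebesgue. f \<omega> x) = (LINT x|lborel. indicator D x * f \<omega> x)"
    by (simp add: set_lebesgue_integral_def integral_completion)
qed

lemma EInt_eq:
  assumes f: "int_D f"
  shows "EInt M D f = (LINT p|(M \<Otimes>\<^sub>M lborel). indicator D (snd p) * f (fst p) (snd p))"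
proof -
  have "EInt M D f = (LINT \<omega>|M. LINT x|lborel. indicator D x * f \<omega> x)"
    unfolding EInt_def by (intro Bochner_Integration.integral_cong inner_integral_lborel f refl)
  also have "\<dots> = (LINT p|(M \<Otimes>\<^sub>M lborel). indicator D (snd p) * f (fst p) (snd p))"
    using pair.integral_fst'[OF f[unfolded int_D_def]] by simp
  finally show ?thesis .
qed

lemma EInt_lincomb:
  assumes "int_D f" "int_D g"
  shows "EInt M D (\<lambda>\<omega> x. a * f \<omega> x + b * g \<omega> x) = a * EInt M D f + b * EInt M D g"
proof -
  have "(\<lambda>p. indicator D (snd p) * (a * f (fst p) (snd p) + b * g (fst p) (snd p))) =
     (\<lambda>p. a * (indicator D (snd p) * f (fst p) (snd p)) + b * (indicator D (snd p) * g (fst p) (snd p)))"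
    by (simp add: algebra_simps)
  then show ?thesis
    using assms by (simp add: EInt_eq int_D_lincomb) (simp add: int_D_def)
qed

text \<open>Completeness is used twice: for Lebesgue measure in the inner integral and for
  \<open>M\<close> in the outer one. Hence no measurability of \<open>f\<close> is assumed.\<close>

lemma EInt_cong_AE:
  assumes g: "int_D g" and ae: "AE_D (\<lambda>\<omega> x. f \<omega> x = g \<omega> x)"
  shows "EInt M D f = EInt M D g"
  unfolding EInt_def
proof (rule integral_cong_AE_complete)
  have "(\<lambda>\<omega>. LINT x|lborel. indicator D x * g \<omega> x) \<in> borel_measurable M"
    using pair.integrable_fst'[OF g[unfolded int_D_def]] by auto
  then show "(\<lambda>\<omega>. LINT x:D|lebesgue. g \<omega> x) \<in> borel_measurable M"
    by (subst measurable_cong[OF inner_integral_lborel(2)[OF g]])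
  show "AE \<omega> in M. (LINT x:D|lebesgue. f \<omega> x) = (LINT x:D|lebesgue. g \<omega> x)"
    using ae[unfolded AE_D_def] AE_space
  proof eventually_elim
    case (elim \<omega>)
    show ?case
      unfolding set_lebesgue_integral_def
    proof (rule completion.integral_cong_AE_complete)
      show "(\<lambda>x. indicat_real D x *\<^sub>R g \<omega> x) \<in> borel_measurable lebesgue"
        using inner_integral_lborel(1)[OF g elim(2)] by (auto intro: measurable_completion)
      have "AE x in lebesgue. x \<in> D \<longrightarrow> f \<omega> x = g \<omega> x"
        using elim(1) by (rule AE_completion)
      then show "AE x in lebesgue. indicat_real D x *\<^sub>R f \<omega> x = indicat_real D x *\<^sub>R g \<omega> x"
        by eventually_elim (auto simp: indicator_def)
    qed
  qed
qed

lemma EInt_nonneg: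
  assumes "AE_D (\<lambda>\<omega> x. 0 \<le> f \<omega> x)"
  shows "0 \<le> EInt M D f"
  unfolding EInt_def
proof (rule integral_nonneg_AE)
  show "AE \<omega> in M. 0 \<le> (LINT x:D|lebesgue. f \<omega> x)"
    using assms[unfolded AE_D_def]
  proof eventually_elim
    case (elim \<omega>)
    have "AE x in lebesgue. x \<in> D \<longrightarrow> 0 \<le> f \<omega> x"
      using elim by (rule AE_completion)
    then show ?case
      unfolding set_lebesgue_integral_def
      by (intro integral_nonneg_AE) (auto elim!: eventually_mono simp: indicator_def)
  qed
qed

section \<open>Square integrable vector fields and their pairing\<close>

definition L2 :: "('w \<Rightarrow> real^'n \<Rightarrow> real^'n) \<Rightarrow> bool" where
  "L2 X \<longleftrightarrow> meas X \<and> int_D (\<lambda>\<omega> x. (norm (X \<omega> x))\<^sup>2)"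

definition dot :: "('w \<Rightarrow> real^'n \<Rightarrow> real^'n) \<Rightarrow> ('w \<Rightarrow> real^'n \<Rightarrow> real^'n) \<Rightarrow> real" where
  "dot X Y = EInt M D (\<lambda>\<omega> x. X \<omega> x \<bullet> Y \<omega> x)"

lemma meas_norm_power2: "meas X \<Longrightarrow> meas (\<lambda>\<omega> x. (norm (X \<omega> x :: real^'n))\<^sup>2)"
  unfolding meas_def by (intro borel_measurable_power measurable_compose[OF _ borel_measurable_norm])

lemma meas_comb: "meas X \<Longrightarrow> meas Y \<Longrightarrow> meas (comb a X b Y :: _ \<Rightarrow> _ \<Rightarrow> real^'n)"
  unfolding meas_def comb_def by (intro borel_measurable_add borel_measurable_scaleR borel_measurable_const)

lemma L2_bound:
  assumes X: "meas X" and Y: "L2 Y" and le: "AE_D (\<lambda>\<omega> x. norm (X \<omega> x) \<le> c * norm (Y \<omega> x))"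
  shows "L2 X"
  unfolding L2_def
proof
  have Ym: "meas (\<lambda>\<omega> x. (norm (Y \<omega> x))\<^sup>2)" and Yi: "int_D (\<lambda>\<omega> x. (norm (Y \<omega> x))\<^sup>2)"
    using Y meas_norm_power2 by (auto simp: L2_def)
  have m: "meas (\<lambda>\<omega> x. c\<^sup>2 * (norm (Y \<omega> x))\<^sup>2)"
    using Ym unfolding meas_def by measurable
  have i: "int_D (\<lambda>\<omega> x. c\<^sup>2 * (norm (Y \<omega> x))\<^sup>2)"
    using int_D_lincomb[OF Yi Yi, of "c\<^sup>2" 0] by simp
  show "int_D (\<lambda>\<omega> x. (norm (X \<omega> x))\<^sup>2)"
  proof (rule int_D_bound[OF meas_norm_power2[OF X] m i AE_D_mp[OF le]])
    fix \<omega> x assume "norm (X \<omega> x) \<le> c * norm (Y \<omega> x)"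
    then have "(norm (X \<omega> x))\<^sup>2 \<le> (c * norm (Y \<omega> x))\<^sup>2" by (intro power_mono) auto
    then show "\<bar>(norm (X \<omega> x))\<^sup>2\<bar> \<le> c\<^sup>2 * (norm (Y \<omega> x))\<^sup>2" by (simp add: power_mult_distrib)
  qed
qed (rule X)

lemma L2_comb:
  assumes "L2 X" "L2 Y"
  shows "L2 (comb a X b Y)"
  unfolding L2_def
proof
  show m: "meas (comb a X b Y)" using assms by (auto simp: L2_def intro: meas_comb)
  have i: "int_D (\<lambda>\<omega> x. 2 * a\<^sup>2 * (norm (X \<omega> x))\<^sup>2 + 2 * b\<^sup>2 * (norm (Y \<omega> x))\<^sup>2)"
    using assms by (intro int_D_lincomb) (auto simp: L2_def)
  have "meas (\<lambda>\<omega> x. (norm (X \<omega> x))\<^sup>2)" "meas (\<lambda>\<omega> x. (norm (Y \<omega> x))\<^sup>2)"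
    using assms meas_norm_power2 by (auto simp: L2_def)
  then have m': "meas (\<lambda>\<omega> x. 2 * a\<^sup>2 * (norm (X \<omega> x))\<^sup>2 + 2 * b\<^sup>2 * (norm (Y \<omega> x))\<^sup>2)"
    unfolding meas_def by (intro borel_measurable_add borel_measurable_times borel_measurable_const)
  have "(norm (a *\<^sub>R v + b *\<^sub>R w))\<^sup>2 \<le> 2 * a\<^sup>2 * (norm v)\<^sup>2 + 2 * b\<^sup>2 * (norm w)\<^sup>2" for v w :: "real^'n"
    using zero_le_power2[of "norm (a *\<^sub>R v - b *\<^sub>R w)"]
    unfolding power2_norm_eq_inner by (simp add: algebra_simps inner_commute power2_eq_square)
  then show "int_D (\<lambda>\<omega> x. (norm (comb a X b Y \<omega> x))\<^sup>2)"
    by (intro int_D_bound[OF meas_norm_power2[OF m] m' i]) (simp add: AE_D_def comb_def)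
qed

lemma int_D_inner:
  assumes "L2 X" "L2 Y"
  shows "int_D (\<lambda>\<omega> x. X \<omega> x \<bullet> Y \<omega> x)"
proof (rule int_D_bound)
  show "meas (\<lambda>\<omega> x. X \<omega> x \<bullet> Y \<omega> x)"
    using assms unfolding L2_def meas_def by (intro borel_measurable_inner) auto
  show "int_D (\<lambda>\<omega> x. 1 * (norm (X \<omega> x))\<^sup>2 + 1 * (norm (Y \<omega> x))\<^sup>2)"
    using assms by (intro int_D_lincomb) (auto simp: L2_def)
  have "meas (\<lambda>\<omega> x. (norm (X \<omega> x))\<^sup>2)" "meas (\<lambda>\<omega> x. (norm (Y \<omega> x))\<^sup>2)"
    using assms meas_norm_power2 by (auto simp: L2_def)
  then show "meas (\<lambda>\<omega> x. 1 * (norm (X \<omega> x))\<^sup>2 + 1 * (norm (Y \<omega> x))\<^sup>2)"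
    unfolding meas_def by (intro borel_measurable_add borel_measurable_times borel_measurable_const)
  have "\<bar>v \<bullet> w\<bar> \<le> (norm v)\<^sup>2 + (norm w)\<^sup>2" for v w :: "real^'n"
  proof -
    have "\<bar>v \<bullet> w\<bar> \<le> norm v * norm w" by (rule Cauchy_Schwarz_ineq2)
    also have "\<dots> \<le> (norm v)\<^sup>2 + (norm w)\<^sup>2"
    proof -
      have "2 * (norm v * norm w) \<le> (norm v)\<^sup>2 + (norm w)\<^sup>2"
        using zero_le_power2[of "norm v - norm w"] by (simp add: power2_diff mult.assoc)
      moreover have "0 \<le> norm v * norm w" by simp
      ultimately show ?thesis by linarith
    qed
    finally show ?thesis .
  qed
  then show "AE_D (\<lambda>\<omega> x. \<bar>X \<omega> x \<bullet> Y \<omega> x\<bar> \<le> 1 * (norm (X \<omega> x))\<^sup>2 + 1 * (norm (Y \<omega> x))\<^sup>2)"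
    by (simp add: AE_D_def)
qed

lemma dot_commute: "dot X Y = dot Y X"
  by (simp add: dot_def inner_commute)

lemma dot_comb_left:
  assumes "L2 X" "L2 Y" "L2 Z"
  shows "dot (comb a X b Y) Z = a * dot X Z + b * dot Y Z"
  using EInt_lincomb[OF int_D_inner[OF assms(1,3)] int_D_inner[OF assms(2,3)], of a b]
  by (simp add: dot_def comb_def inner_add_left)

lemma EInt_cong_dot:
  assumes "L2 X" "L2 Y" "AE_D (\<lambda>\<omega> x. f \<omega> x = X \<omega> x \<bullet> Y \<omega> x)"
  shows "EInt M D f = dot X Y"
  unfolding dot_def using assms by (intro EInt_cong_AE int_D_inner)

text \<open>\<open>Hspace\<close> only provides an integrable function of \<open>\<omega>\<close>,
  whose values would be 0 at non-integrable sections. Such sections are excluded almost surely by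
  the square integrability inside \<open>has_weak_gradient\<close>; only then does Fubini's
  criterion yield integrability over the product.\<close>

lemma L2_rgrad:
  assumes v: "v \<in> Hspace M D \<Gamma>"
  shows "L2 (rgrad M D v)"
proof -
  let ?G = "rgrad M D v"
  have G: "is_rgrad M D v ?G"
    using v by (auto simp: Hspace_def intro: is_rgrad_rgrad)
  have m: "meas ?G" using G by (simp add: is_rgrad_def meas_def case_prod_unfold)
  have sec: "(\<lambda>x. indicator D x * (norm (?G \<omega> x))\<^sup>2) \<in> borel_measurable borel" if "\<omega> \<in> space M" for \<omega>
    by (intro borel_measurable_times borel_measurable_indicator borel_measurable_power
        measurable_compose[OF is_rgrad_section_measurable[OF G that] borel_measurable_norm]) simp
  have ae: "AE \<omega> in M. integrable lborel (\<lambda>x. indicator D x * (norm (?G \<omega> x))\<^sup>2) \<and>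
     integrable lebesgue (\<lambda>x. indicator D x * ((v \<omega> x)\<^sup>2 + (norm (?G \<omega> x))\<^sup>2))"
    using conjunct2[OF G[unfolded is_rgrad_def]] AE_space
  proof eventually_elim
    case (elim \<omega>)
    then have "set_integrable lebesgue D (\<lambda>x. (v \<omega> x)\<^sup>2)"
      "\<And>i. set_integrable lebesgue D (\<lambda>x. (?G \<omega> x $ i)\<^sup>2)"
      by (auto simp: has_weak_gradient_def sq_int_on_def)
    then have iv: "integrable lebesgue (\<lambda>x. indicator D x * (v \<omega> x)\<^sup>2)"
      and "\<And>i. integrable lebesgue (\<lambda>x. indicator D x * (?G \<omega> x $ i)\<^sup>2)"
      unfolding set_integrable_def real_scaleR_def by this+
    from this(2) have "integrable lebesgue (\<lambda>x. \<Sum>i\<in>UNIV. indicator D x * (?G \<omega> x $ i)\<^sup>2)"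
      by (rule Bochner_Integration.integrable_sum)
    moreover have "(\<Sum>i\<in>UNIV. indicator D x * (?G \<omega> x $ i)\<^sup>2) = indicator D x * (norm (?G \<omega> x))\<^sup>2" for x
      unfolding power2_norm_eq_inner by (simp add: inner_vec_def power2_eq_square sum_distrib_left)
    ultimately have iG: "integrable lebesgue (\<lambda>x. indicator D x * (norm (?G \<omega> x))\<^sup>2)"
      by simp
    then have "integrable lborel (\<lambda>x. indicator D x * (norm (?G \<omega> x))\<^sup>2)"
      using sec[OF elim(2)] by (simp add: integrable_completion)
    then show ?case
      using Bochner_Integration.integrable_add[OF iv iG] by (simp add: distrib_left)
  qed
  have "int_D (\<lambda>\<omega> x. (norm (?G \<omega> x))\<^sup>2)"
    unfolding int_D_def
  proof (rule pair.Fubini_integrable)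
    show pm: "(\<lambda>p. indicator D (snd p) * (norm (?G (fst p) (snd p)))\<^sup>2) \<in> borel_measurable (M \<Otimes>\<^sub>M lborel)"
      using meas_norm_power2[OF m] unfolding meas_def by (intro borel_measurable_times indicator_snd_measurable)
    show "AE \<omega> in M. integrable lborel (\<lambda>x. indicator D (snd (\<omega>, x)) * (norm (?G (fst (\<omega>, x)) (snd (\<omega>, x))))\<^sup>2)"
      using ae by eventually_elim simp
    have "integrable M (\<lambda>\<omega>. LINT x|lborel. indicator D x * (norm (?G \<omega> x))\<^sup>2)"
    \<comment> \<open>The gradient part is dominated by the full H1 density, whose integral is
      integrable in \<open>\<omega>\<close> by membership in \<open>Hspace\<close>.\<close>
    proof (rule Bochner_Integration.integrable_bound)
      show "integrable M (\<lambda>\<omega>. LINT x:D|lebesgue. (v \<omega> x)\<^sup>2 + (norm (?G \<omega> x))\<^sup>2)"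
        using v by (simp add: Hspace_def)
      show "(\<lambda>\<omega>. LINT x|lborel. indicator D x * (norm (?G \<omega> x))\<^sup>2) \<in> borel_measurable M"
        using pm by (intro lborel.borel_measurable_lebesgue_integral) (simp add: split_beta)
      show "AE \<omega> in M. norm (LINT x|lborel. indicator D x * (norm (?G \<omega> x))\<^sup>2)
          \<le> norm (LINT x:D|lebesgue. (v \<omega> x)\<^sup>2 + (norm (?G \<omega> x))\<^sup>2)"
        using ae AE_space
      proof eventually_elim
        case (elim \<omega>)
        have "(LINT x|lborel. indicator D x * (norm (?G \<omega> x))\<^sup>2) = (LINT x|lebesgue. indicator D x * (norm (?G \<omega> x))\<^sup>2)"
          using sec[OF elim(2)] by (simp add: integral_completion)
        also have "\<dots> \<le> (LINT x|lebesgue. indicator D x * ((v \<omega> x)\<^sup>2 + (norm (?G \<omega> x))\<^sup>2))"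
          using elim sec[OF elim(2)]
          by (intro integral_mono) (auto simp: integrable_completion indicator_def)
        finally show ?case
          by (simp add: set_lebesgue_integral_def abs_of_nonneg integral_nonneg_AE)
      qed
    qed
    then show "integrable M (\<lambda>\<omega>. LINT x|lborel. norm (indicator D (snd (\<omega>, x)) * (norm (?G (fst (\<omega>, x)) (snd (\<omega>, x))))\<^sup>2))"
      by simp
  qed
  with m show ?thesis by (simp add: L2_def)
qed

text \<open>Both sides are random gradients of the same combination, so uniqueness applies. The
  explicit combination also witnesses that the choice on the left succeeds, so membership of
  \<open>lc a u b v\<close> in \<open>Hspace\<close> does not have to be shown.\<close>

lemma rgrad_lc:
  assumes u: "u \<in> Hspace M D \<Gamma>" and v: "v \<in> Hspace M D \<Gamma>"
  shows "AE_D (\<lambda>\<omega> x. rgrad M D (lc a u b v) \<omega> x = comb a (rgrad M D u) b (rgrad M D v) \<omega> x)"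
proof -
  have "is_rgrad M D u (rgrad M D u)" "is_rgrad M D v (rgrad M D v)"
    using u v by (auto simp: Hspace_def intro: is_rgrad_rgrad)
  note lc = is_rgrad_lc[OF D this, of a b]
  show ?thesis
    unfolding AE_D_def comb_def by (rule is_rgrad_unique[OF D is_rgrad_rgrad[OF lc] lc])
qed

end

subsection \<open>The energy form\<close>

locale elliptic_coefficients = random_domain M D
  for M :: "'w measure" and D :: "(real^'n) set" +
  fixes A A0 :: "'w \<Rightarrow> real^'n \<Rightarrow> real^'n^'n" and \<alpha>min \<alpha>max C0 :: real
  assumes A_meas: "meas A" and A0_meas: "meas A0"
    and A_sym: "transpose (A \<omega> x) = A \<omega> x" and A0_sym: "transpose (A0 \<omega> x) = A0 \<omega> x"
    and \<alpha>min_pos: "0 < \<alpha>min"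
    and A_ell: "AE_D (\<lambda>\<omega> x. \<forall>a. \<alpha>min * (norm a)\<^sup>2 \<le> a \<bullet> (A \<omega> x *v a) \<and> a \<bullet> (A \<omega> x *v a) \<le> \<alpha>max * (norm a)\<^sup>2)"
    and A0_bdd: "AE_D (\<lambda>\<omega> x. norm (A0 \<omega> x) \<le> C0)"
begin

definition app :: "('w \<Rightarrow> real^'n \<Rightarrow> real^'n^'n) \<Rightarrow> ('w \<Rightarrow> real^'n \<Rightarrow> real^'n) \<Rightarrow> 'w \<Rightarrow> real^'n \<Rightarrow> real^'n" where
  "app K X = (\<lambda>\<omega> x. K \<omega> x *v X \<omega> x)"

text \<open>A jointly measurable version of the field that multiplication by \<open>I0 A A0\<close> produces.\<close>

definition defect :: "('w \<Rightarrow> real^'n \<Rightarrow> real^'n) \<Rightarrow> 'w \<Rightarrow> real^'n \<Rightarrow> real^'n" where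
  "defect X = (\<lambda>\<omega> x. cramer_solve (A \<omega> x) (comb 1 (app A X) (- 1) (app A0 X) \<omega> x))"

text \<open>The arguments are vector fields rather than functions, since a \<open>defect\<close> is
  in general not a gradient.\<close>

definition energy :: "('w \<Rightarrow> real^'n \<Rightarrow> real^'n) \<Rightarrow> ('w \<Rightarrow> real^'n \<Rightarrow> real^'n) \<Rightarrow> real" where
  "energy X Y = dot (app A X) Y"

lemma app_comb: "app K (comb a X b Y) = comb a (app K X) b (app K Y)"
  by (simp add: app_def comb_def fun_eq_iff matrix_vector_right_distrib matrix_vector_mult_scaleR)

lemma meas_app: "meas K \<Longrightarrow> meas X \<Longrightarrow> meas (app K X)"
  unfolding meas_def app_def by (rule borel_measurable_matrix_vector_mult)

lemma L2_app_A:
  assumes "L2 X"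
  shows "L2 (app A X)"
proof (rule L2_bound[OF _ assms])
  show "meas (app A X)" using assms A_meas by (auto simp: L2_def intro: meas_app)
  show "AE_D (\<lambda>\<omega> x. norm (app A X \<omega> x) \<le> \<alpha>max * norm (X \<omega> x))"
  proof (rule AE_D_mp[OF A_ell])
    fix \<omega> x
    assume ell: "\<forall>a. \<alpha>min * (norm a)\<^sup>2 \<le> a \<bullet> (A \<omega> x *v a) \<and> a \<bullet> (A \<omega> x *v a) \<le> \<alpha>max * (norm a)\<^sup>2"
    have "0 \<le> a \<bullet> (A \<omega> x *v a)" for a
      using ell \<alpha>min_pos by (meson less_imp_le mult_nonneg_nonneg order_trans zero_le_power2)
    then show "norm (app A X \<omega> x) \<le> \<alpha>max * norm (X \<omega> x)"
      unfolding app_def using ell by (intro norm_symmetric_matrix_le A_sym) auto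
  qed
qed

lemma L2_app_A0:
  assumes "L2 X"
  shows "L2 (app A0 X)"
proof (rule L2_bound[OF _ assms])
  show "meas (app A0 X)" using assms A0_meas by (auto simp: L2_def intro: meas_app)
  show "AE_D (\<lambda>\<omega> x. norm (app A0 X \<omega> x) \<le> real CARD('n) * C0 * norm (X \<omega> x))"
  proof (rule AE_D_mp[OF A0_bdd])
    fix \<omega> x assume "norm (A0 \<omega> x) \<le> C0"
    then have "real CARD('n) * norm (A0 \<omega> x) * norm (X \<omega> x) \<le> real CARD('n) * C0 * norm (X \<omega> x)"
      by (intro mult_right_mono mult_left_mono) auto
    then show "norm (app A0 X \<omega> x) \<le> real CARD('n) * C0 * norm (X \<omega> x)"
      unfolding app_def by (rule order_trans[OF norm_matrix_vector_mult_le])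
  qed
qed

lemma L2_defect:
  assumes "L2 X"
  shows "L2 (defect X)"
proof -
  let ?Y = "comb 1 (app A X) (- 1) (app A0 X)"
  have Y: "L2 ?Y" using assms by (intro L2_comb L2_app_A L2_app_A0)
  show ?thesis
  proof (rule L2_bound[OF _ Y])
    show "meas (defect X)"
      using Y A_meas unfolding L2_def meas_def defect_def by (intro borel_measurable_cramer_solve) auto
    show "AE_D (\<lambda>\<omega> x. norm (defect X \<omega> x) \<le> (1 / \<alpha>min) * norm (?Y \<omega> x))"
      by (rule AE_D_mp[OF A_ell]) (use elliptic_cramer_solve_norm_le[OF \<alpha>min_pos] in \<open>auto simp: defect_def\<close>)
  qed
qed

lemma AE_invertible: "AE_D (\<lambda>\<omega> x. invertible (A \<omega> x))"
  by (rule AE_D_mp[OF A_ell]) (rule elliptic_matrix_invertible[OF \<alpha>min_pos], auto)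

lemma I0_eq_defect:
  assumes "invertible (A \<omega> x)"
  shows "I0 A A0 \<omega> x *v X \<omega> x = defect X \<omega> x"
    and "A \<omega> x *v defect X \<omega> x = A \<omega> x *v X \<omega> x - A0 \<omega> x *v X \<omega> x"
  using matrix_inv_defect_eq_cramer_solve[OF assms, of "A0 \<omega> x" "X \<omega> x"] cramer_solve[OF assms]
  by (simp_all add: I0_def defect_def app_def comb_def matrix_vector_mult_diff_rdistrib)

lemma energy_commute: "energy X Y = energy Y X"
proof -
  have "app A X \<omega> x \<bullet> Y \<omega> x = app A Y \<omega> x \<bullet> X \<omega> x" for \<omega> x
    unfolding app_def by (subst inner_symmetric_matrix[OF A_sym]) (rule inner_commute)
  then show ?thesis by (simp add: energy_def dot_def)
qed

lemma energy_comb_left: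
  "L2 X \<Longrightarrow> L2 Y \<Longrightarrow> L2 Z \<Longrightarrow> energy (comb a X b Y) Z = a * energy X Z + b * energy Y Z"
  unfolding energy_def app_comb by (rule dot_comb_left) (auto intro: L2_app_A)

lemma energy_comb_right:
  "L2 X \<Longrightarrow> L2 Y \<Longrightarrow> L2 Z \<Longrightarrow> energy Z (comb a X b Y) = a * energy Z X + b * energy Z Y"
  using energy_comb_left[of X Y Z a b] energy_commute by simp

lemma energy_nonneg: "0 \<le> energy X X"
  unfolding energy_def dot_def
proof (rule EInt_nonneg, rule AE_D_mp[OF A_ell])
  fix \<omega> x
  assume "\<forall>a. \<alpha>min * (norm a)\<^sup>2 \<le> a \<bullet> (A \<omega> x *v a) \<and> a \<bullet> (A \<omega> x *v a) \<le> \<alpha>max * (norm a)\<^sup>2"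
  then show "0 \<le> app A X \<omega> x \<bullet> X \<omega> x"
    using \<alpha>min_pos unfolding app_def inner_commute[of _ "X \<omega> x"]
    by (meson less_imp_le mult_nonneg_nonneg order_trans zero_le_power2)
qed

text \<open>\<open>A\<close> cancels the inverse in \<open>I0\<close> and leaves
  \<open>A - A0\<close>. This identity links the energy product to the surrogate equations.\<close>

lemma energy_defect:
  assumes X: "L2 X" and Y: "L2 Y"
  shows "energy (defect X) Y = energy X Y - dot (app A0 X) Y"
proof -
  have "energy (defect X) Y = dot (comb 1 (app A X) (- 1) (app A0 X)) Y"
    unfolding energy_def dot_def[of "app A (defect X)"]
  proof (rule EInt_cong_dot[OF L2_comb[OF L2_app_A[OF X] L2_app_A0[OF X]] Y])
    show "AE_D (\<lambda>\<omega> x. app A (defect X) \<omega> x \<bullet> Y \<omega> x = comb 1 (app A X) (- 1) (app A0 X) \<omega> x \<bullet> Y \<omega> x)"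
      by (rule AE_D_mp[OF AE_invertible]) (simp add: app_def comb_def I0_eq_defect(2)[unfolded app_def])
  qed
  then show ?thesis
    by (simp add: dot_comb_left[OF L2_app_A[OF X] L2_app_A0[OF X] Y] energy_def)
qed

text \<open>If \<open>p + z\<close> is orthogonal to \<open>z\<close> and \<open>g\<close>, then \<open>- z\<close> is the projection of \<open>p\<close> to the
  span of \<open>z\<close> and \<open>g\<close>. With \<open>P\<close> that projection, \<open>\<langle>P p, P q\<rangle>\<close> is a quarter of the difference of
  the squared norms of \<open>P (s p \<plusminus> q/s)\<close>; the first is at most that of \<open>s p + q/s\<close>, the second at least
  the component along \<open>g\<close>. Written out, this is the positivity of one explicit combination.\<close>

lemma energy_polarization_bound:
  assumes L: "L2 p" "L2 q" "L2 z" "L2 g"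
    and z: "energy p z = - energy z z" and g: "energy p g = - energy z g"
    and gg: "energy g g \<noteq> 0" and s: "s \<noteq> 0" and \<sigma>: "\<sigma>\<^sup>2 = 1"
  shows "- \<sigma> * energy q z \<le>
    (1/4) * (s\<^sup>2 * energy p p + (1 / s\<^sup>2) * energy q q + 2 * \<sigma> * energy p q)
    - (1/4) * ((s * energy p g - \<sigma> / s * energy q g)\<^sup>2 / energy g g)"
proof -
  define N where "N = s * energy p g - \<sigma> / s * energy q g"
  \<comment> \<open>\<open>t\<close> minimises \<open>t\<^sup>2 * energy g g - 2 * t * N\<close>;
    equivalently, \<open>t\<close> times \<open>g\<close> is the component of
    \<open>s p - (\<sigma>/s) q\<close> along \<open>g\<close>.\<close>
  define t where "t = N / energy g g"
  \<comment> \<open>Since \<open>p\<close> projects to \<open>- z\<close>, adding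
    \<open>2 s z\<close> reflects the projected part of \<open>s p\<close>. So \<open>X\<close> has
    the part of \<open>s p + (\<sigma>/s) q\<close> orthogonal to the span, and in the span the
    negative of the projection of \<open>s p - (\<sigma>/s) q\<close> with its component along
    \<open>g\<close> removed. Its energy is the sum of the losses in the two estimates.\<close>
  define X where "X = comb 1 (comb s p (\<sigma> / s) q) 1 (comb (2 * s) z t g)"
  note comm = energy_commute[of q p] energy_commute[of z p] energy_commute[of g p]
    energy_commute[of z q] energy_commute[of g q] energy_commute[of g z]
  have "energy X X = s\<^sup>2 * energy p p + (\<sigma> / s)\<^sup>2 * energy q q + 2 * (s * (\<sigma> / s)) * energy p q
     + 4 * s\<^sup>2 * energy z z + t\<^sup>2 * energy g g + 4 * s\<^sup>2 * energy p z + 2 * s * t * energy p g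
     + 4 * (s * (\<sigma> / s)) * energy q z + 2 * t * (\<sigma> / s * energy q g) + 4 * s * t * energy z g"
    unfolding X_def
    by (simp only: energy_comb_left energy_comb_right L2_comb L comm)
      (simp add: power2_eq_square algebra_simps)
  also have "s * (\<sigma> / s) = \<sigma>" using s by simp
  also have "(\<sigma> / s)\<^sup>2 = 1 / s\<^sup>2" using \<sigma> by (simp add: power_divide)
  finally have "energy X X = s\<^sup>2 * energy p p + (1 / s\<^sup>2) * energy q q + 2 * \<sigma> * energy p q
      + 4 * \<sigma> * energy q z + (t\<^sup>2 * energy g g - 2 * t * N)"
    unfolding z N_def using g by (simp add: algebra_simps)
  also have "t\<^sup>2 * energy g g - 2 * t * N = - (N\<^sup>2 / energy g g)"
    using gg by (simp add: t_def power2_eq_square field_simps)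
  finally have "0 \<le> s\<^sup>2 * energy p p + (1 / s\<^sup>2) * energy q q + 2 * \<sigma> * energy p q
      + 4 * (\<sigma> * energy q z) + - (N\<^sup>2 / energy g g)"
    using energy_nonneg[of X] by (simp only: mult.assoc)
  moreover have "- d \<le> 1 / 4 * (a + b + c) - 1 / 4 * w" if "0 \<le> a + b + c + 4 * d + - w" for a b c d w :: real
    using that by (simp add: algebra_simps)
  ultimately show ?thesis unfolding N_def mult_minus_left by blast
qed

section \<open>The forms of the statement as energy products\<close>

lemma Bform_A_eq_energy:
  assumes "AE_D (\<lambda>\<omega> x. rgrad M D v \<omega> x = V \<omega> x)" "AE_D (\<lambda>\<omega> x. rgrad M D w \<omega> x = W \<omega> x)"
    and "L2 V" "L2 W"
  shows "Bform M D A v w = energy V W"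
  unfolding Bform_def energy_def
  by (rule EInt_cong_dot[OF L2_app_A[OF assms(3)] assms(4)], rule AE_D_mp[OF AE_D_conj[OF assms(1,2)]])
    (simp add: app_def)

text \<open>The first argument is a combination because the residual is needed at
  \<open>s u0\<close> plus or minus \<open>w0 / s\<close>; a single function is the case of
  coefficients 1 and 0.\<close>

lemma Rres_eq_energy:
  assumes v: "AE_D (\<lambda>\<omega> x. rgrad M D v \<omega> x = comb a U b V \<omega> x)"
    and w: "AE_D (\<lambda>\<omega> x. rgrad M D w \<omega> x = W \<omega> x)"
    and L: "L2 U" "L2 V" "L2 W"
  shows "Rres M D A A0 v w = a * energy (defect U) W + b * energy (defect V) W"
proof -
  have "Rres M D A A0 v w = energy (comb a (defect U) b (defect V)) W"
    unfolding Rres_def energy_def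
  proof (rule EInt_cong_dot[OF L2_app_A[OF L2_comb[OF L2_defect[OF L(1)] L2_defect[OF L(2)]]] L(3)],
      rule AE_D_mp[OF AE_D_conj[OF AE_invertible AE_D_conj[OF v w]]])
    fix \<omega> x
    assume *: "invertible (A \<omega> x) \<and> rgrad M D v \<omega> x = comb a U b V \<omega> x \<and> rgrad M D w \<omega> x = W \<omega> x"
    then have inv: "invertible (A \<omega> x)" by simp
    have "A \<omega> x *v (I0 A A0 \<omega> x *v rgrad M D v \<omega> x) = app A (comb a (defect U) b (defect V)) \<omega> x"
      unfolding I0_eq_defect[OF inv] app_comb using *
      by (simp add: app_def comb_def I0_eq_defect(2)[OF inv] matrix_vector_right_distrib
          matrix_vector_mult_scaleR algebra_simps)
    then show "(A \<omega> x *v (I0 A A0 \<omega> x *v rgrad M D v \<omega> x)) \<bullet> rgrad M D w \<omega> x =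
        app A (comb a (defect U) b (defect V)) \<omega> x \<bullet> W \<omega> x"
      using * by simp
  qed
  then show ?thesis using L by (simp add: energy_comb_left L2_defect)
qed

lemma Jform_eq_energy:
  assumes "L2 (rgrad M D v)" "L2 (rgrad M D w)"
  shows "Jform M D A A0 v w = energy (defect (rgrad M D v)) (defect (rgrad M D w))"
proof -
  have "Jform M D A A0 v w = dot (defect (rgrad M D v)) (app A (defect (rgrad M D w)))"
    unfolding Jform_def
    by (rule EInt_cong_dot[OF L2_defect[OF assms(1)] L2_app_A[OF L2_defect[OF assms(2)]]],
        rule AE_D_mp[OF AE_invertible])
      (simp add: app_def I0_eq_defect(1))
  then show ?thesis
    unfolding dot_commute[of "defect _"] energy_commute[of "defect (rgrad M D v)"] by (simp add: energy_def)
qed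

lemma Bform_A0_eq_dot:
  assumes "L2 (rgrad M D v)" "L2 (rgrad M D w)"
  shows "Bform M D A0 v w = dot (app A0 (rgrad M D v)) (rgrad M D w)"
  by (simp add: Bform_def dot_def app_def)

lemma dot_app_A0_commute: "dot (app A0 X) Y = dot (app A0 Y) X"
proof -
  have "app A0 X \<omega> x \<bullet> Y \<omega> x = app A0 Y \<omega> x \<bullet> X \<omega> x" for \<omega> x
    unfolding app_def by (subst inner_symmetric_matrix[OF A0_sym]) (rule inner_commute)
  then show ?thesis by (simp add: dot_def)
qed

end

theorem theorem1:
  fixes M :: "'w measure"
    and D \<Gamma>D :: "(real^'n) set"
    and A A0 :: "'w \<Rightarrow> real^'n \<Rightarrow> real^'n^'n"
    and \<alpha>min \<alpha>max C0 s :: real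
    and F Q :: "('w \<Rightarrow> real^'n \<Rightarrow> real) \<Rightarrow> real"
    and u u0 w0 :: "'w \<Rightarrow> real^'n \<Rightarrow> real"
  assumes dim: "CARD('n) \<in> {1, 2, 3}"
    and dom: "lipschitz_domain D"
    and GD: "\<Gamma>D \<subseteq> frontier D"
    and prob: "prob_space M"
    and compl: "complete_measure M"
    and A_meas: "(\<lambda>(\<omega>,x). A \<omega> x) \<in> borel_measurable (M \<Otimes>\<^sub>M lborel)"
    and A_sym: "\<forall>\<omega> x. transpose (A \<omega> x) = A \<omega> x"
    and alpha: "0 < \<alpha>min" "\<alpha>min \<le> \<alpha>max"
    and A_ell: "AE \<omega> in M. AE x in lebesgue_on D. \<forall>a::real^'n.
                  \<alpha>min * (norm a)\<^sup>2 \<le> a \<bullet> (A \<omega> x *v a) \<and> a \<bullet> (A \<omega> x *v a) \<le> \<alpha>max * (norm a)\<^sup>2"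
    and A0_meas: "(\<lambda>(\<omega>,x). A0 \<omega> x) \<in> borel_measurable (M \<Otimes>\<^sub>M lborel)"
    and A0_sym: "\<forall>\<omega> x. transpose (A0 \<omega> x) = A0 \<omega> x"
    and A0_bdd: "AE \<omega> in M. AE x in lebesgue_on D. norm (A0 \<omega> x) \<le> C0"
    and F_lin: "bounded_linear_fun_on M D \<Gamma>D F"
    and Q_lin: "bounded_linear_fun_on M D \<Gamma>D Q"
    and u_H: "u \<in> Hspace M D \<Gamma>D"
    and u_eq: "\<forall>v\<in>Hspace M D \<Gamma>D. Bform M D A u v = F v"
    and u0_H: "u0 \<in> Hspace M D \<Gamma>D"
    and u0_eq: "\<forall>v\<in>Hspace M D \<Gamma>D. Bform M D A0 u0 v = F v"
    and w0_H: "w0 \<in> Hspace M D \<Gamma>D"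
    and w0_eq: "\<forall>v\<in>Hspace M D \<Gamma>D. Bform M D A0 v w0 = Q v"
    and s_nz: "s \<noteq> 0"
    and vp_def: "vp = lc s u0 (1 / s) w0"
    and vm_def: "vm = lc s u0 (- 1 / s) w0"
    and thp_def: "\<theta>p = (Bform M D A u0 w0 * Rres M D A A0 u0 vp - Bform M D A u0 u0 * Rres M D A A0 w0 vp)
                 / (Bform M D A u0 w0 * Rres M D A A0 w0 vp - Bform M D A w0 w0 * Rres M D A A0 u0 vp)"
    and thm_def: "\<theta>m = (Bform M D A u0 w0 * Rres M D A A0 u0 vm - Bform M D A u0 u0 * Rres M D A A0 w0 vm)
                 / (Bform M D A u0 w0 * Rres M D A A0 w0 vm - Bform M D A w0 w0 * Rres M D A A0 u0 vm)"
    and den_thp: "Bform M D A u0 w0 * Rres M D A A0 w0 vp - Bform M D A w0 w0 * Rres M D A A0 u0 vp \<noteq> 0"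
    and den_thm: "Bform M D A u0 w0 * Rres M D A A0 w0 vm - Bform M D A w0 w0 * Rres M D A A0 u0 vm \<noteq> 0"
    and den_lowp: "sqrt (Bform M D A (lc 1 u0 \<theta>p w0) (lc 1 u0 \<theta>p w0)) \<noteq> 0"
    and den_lowm: "sqrt (Bform M D A (lc 1 u0 \<theta>m w0) (lc 1 u0 \<theta>m w0)) \<noteq> 0"
    and etalowp_def: "eta_low_p = \<bar>Rres M D A A0 vp (lc 1 u0 \<theta>p w0)\<bar>
                                    / sqrt (Bform M D A (lc 1 u0 \<theta>p w0) (lc 1 u0 \<theta>p w0))"
    and etalowm_def: "eta_low_m = \<bar>Rres M D A A0 vm (lc 1 u0 \<theta>m w0)\<bar>
                                    / sqrt (Bform M D A (lc 1 u0 \<theta>m w0) (lc 1 u0 \<theta>m w0))"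
    and etauppp_def: "eta_upp_p_sq = s\<^sup>2 * Jform M D A A0 u0 u0 + (1 / s\<^sup>2) * Jform M D A A0 w0 w0
                                    + 2 * Jform M D A A0 u0 w0"
    and etauppm_def: "eta_upp_m_sq = s\<^sup>2 * Jform M D A A0 u0 u0 + (1 / s\<^sup>2) * Jform M D A A0 w0 w0
                                    - 2 * Jform M D A A0 u0 w0"
  shows "(1/4) * eta_low_p\<^sup>2 - (1/4) * eta_upp_m_sq - Rres M D A A0 u0 w0 \<le> Q (lc 1 u (- 1) u0)
       \<and> Q (lc 1 u (- 1) u0) \<le> (1/4) * eta_upp_p_sq - (1/4) * eta_low_m\<^sup>2 - Rres M D A A0 u0 w0"
proof -
  have D: "open D" "bounded D" using dom by (auto simp: lipschitz_domain_def)
  interpret prob_space M by (rule prob)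
  interpret complete_measure M by (rule compl)
  interpret random_domain M D
    by unfold_locales (use D in auto)
  interpret elliptic_coefficients M D A A0 \<alpha>min \<alpha>max C0
  proof unfold_locales
    show "meas A" "meas A0"
      using A_meas A0_meas by (simp_all add: meas_def case_prod_unfold)
    show "transpose (A \<omega> x) = A \<omega> x" "transpose (A0 \<omega> x) = A0 \<omega> x" for \<omega> x
      using A_sym A0_sym by auto
    show "AE_D (\<lambda>\<omega> x. \<forall>a. \<alpha>min * (norm a)\<^sup>2 \<le> a \<bullet> (A \<omega> x *v a) \<and> a \<bullet> (A \<omega> x *v a) \<le> \<alpha>max * (norm a)\<^sup>2)"
      "AE_D (\<lambda>\<omega> x. norm (A0 \<omega> x) \<le> C0)"
      using A_ell A0_bdd unfolding AE_D_def AE_lebesgue_on_iff[OF D_sets(1)] by this+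
  qed (rule alpha)
  let ?Gu = "rgrad M D u" and ?Gv = "rgrad M D u0" and ?Gw = "rgrad M D w0"
  define z where "z = comb 1 ?Gu (- 1) ?Gv"
  define p where "p = defect ?Gv"
  define q where "q = defect ?Gw"
  have L [simp]: "L2 ?Gu" "L2 ?Gv" "L2 ?Gw"
    using L2_rgrad u_H u0_H w0_H by auto
  have Lz [simp]: "L2 z" "L2 p" "L2 q"
    by (simp_all add: z_def p_def q_def L2_comb L2_defect)
  have triv: "AE_D (\<lambda>\<omega> x. rgrad M D v \<omega> x = rgrad M D v \<omega> x)" for v
    by (simp add: AE_D_def)
  have orth: "energy p (rgrad M D v) = - energy z (rgrad M D v)" if v: "v \<in> Hspace M D \<Gamma>D" for v
  proof -
    have Lv: "L2 (rgrad M D v)" using v by (rule L2_rgrad)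
    have "energy ?Gu (rgrad M D v) = dot (app A0 ?Gv) (rgrad M D v)"
      using u_eq u0_eq v Bform_A0_eq_dot[OF L(2) Lv] Bform_A_eq_energy[OF triv triv L(1) Lv] by simp
    then show ?thesis
      by (simp add: p_def z_def energy_defect energy_comb_left Lv)
  qed
  \<comment> \<open>Orthogonality is applied to \<open>u\<close> and \<open>u0\<close> separately
    and then subtracted, so the error itself need not be placed in \<open>Hspace\<close>.\<close>
  have pz: "energy p z = - energy z z"
    using energy_comb_right[OF L(1,2) Lz(2), of 1 "- 1"] energy_comb_right[OF L(1,2) Lz(1), of 1 "- 1"]
      orth[OF u_H] orth[OF u0_H] by (simp flip: z_def)
  have Q_eq: "Q (lc 1 u (- 1) u0) = - Rres M D A A0 u0 w0 - energy q z"
  proof -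
    have "Q (lc 1 u (- 1) u0) = Q u - Q u0"
    proof -
      have "Q (lc 1 u (- 1) u0) = 1 * Q u + (- 1) * Q u0"
        unfolding lc_def
        using Q_lin[unfolded bounded_linear_fun_on_def, THEN conjunct1, rule_format, OF u_H u0_H] .
      then show ?thesis by simp
    qed
    also have "\<dots> = dot (app A0 ?Gu) ?Gw - dot (app A0 ?Gv) ?Gw"
      using w0_eq[rule_format, OF u_H] w0_eq[rule_format, OF u0_H]
        Bform_A0_eq_dot[OF L(1,3)] Bform_A0_eq_dot[OF L(2,3)] by simp
    also have "\<dots> = dot (app A0 z) ?Gw"
      unfolding z_def app_comb by (simp add: dot_comb_left L2_app_A0)
    \<comment> \<open>Symmetry of \<open>A0\<close> moves it from \<open>z\<close> to the gradient
      of \<open>w0\<close>, where the defect \<open>q\<close> appears.\<close>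
    also have "\<dots> = energy z ?Gw - energy q z"
      by (simp add: q_def energy_defect dot_app_A0_commute[of z] energy_commute[of z])
    also have "energy z ?Gw = - energy p ?Gw"
      using orth[OF w0_H] by simp
    also have "energy p ?Gw = Rres M D A A0 u0 w0"
      using Rres_eq_energy[of u0 1 ?Gv 0 ?Gv w0 ?Gw] by (simp add: triv AE_D_def comb_def p_def)
    finally show ?thesis .
  qed
  \<comment> \<open>The sign in \<open>v\<close> is opposite to the one in the mixed term:
    \<open>\<sigma> = - 1\<close> pairs \<open>vp\<close> with \<open>eta_upp_m_sq\<close> for the
    lower bound, and \<open>\<sigma> = 1\<close> pairs \<open>vm\<close> with
    \<open>eta_upp_p_sq\<close> for the upper one.\<close>
  have bound: "- \<sigma> * energy q z \<le>
      (1/4) * (s\<^sup>2 * Jform M D A A0 u0 u0 + (1 / s\<^sup>2) * Jform M D A A0 w0 w0 + 2 * \<sigma> * Jform M D A A0 u0 w0)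
      - (1/4) * (\<bar>Rres M D A A0 v (lc 1 u0 \<theta> w0)\<bar> / sqrt (Bform M D A (lc 1 u0 \<theta> w0) (lc 1 u0 \<theta> w0)))\<^sup>2"
    if v: "v = lc s u0 (- \<sigma> / s) w0" and \<sigma>: "\<sigma>\<^sup>2 = 1"
      and nz: "sqrt (Bform M D A (lc 1 u0 \<theta> w0) (lc 1 u0 \<theta> w0)) \<noteq> 0" for \<sigma> \<theta> v
  proof -
    define g where "g = comb 1 ?Gv \<theta> ?Gw"
    have Lg: "L2 g" by (simp add: g_def L2_comb)
    have ae_g: "AE_D (\<lambda>\<omega> x. rgrad M D (lc 1 u0 \<theta> w0) \<omega> x = g \<omega> x)"
      unfolding g_def by (rule rgrad_lc[OF u0_H w0_H])
    have B: "Bform M D A (lc 1 u0 \<theta> w0) (lc 1 u0 \<theta> w0) = energy g g"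
      by (rule Bform_A_eq_energy[OF ae_g ae_g Lg Lg])
    have R: "Rres M D A A0 v (lc 1 u0 \<theta> w0) = s * energy p g - \<sigma> / s * energy q g"
      using Rres_eq_energy[OF rgrad_lc[OF u0_H w0_H] ae_g L(2,3) Lg] by (simp add: v p_def q_def)
    have pg: "energy p g = - energy z g"
      unfolding g_def by (simp add: energy_comb_right orth u0_H w0_H)
    have gg: "energy g g \<noteq> 0" using nz B by auto
    have "(\<bar>Rres M D A A0 v (lc 1 u0 \<theta> w0)\<bar> / sqrt (Bform M D A (lc 1 u0 \<theta> w0) (lc 1 u0 \<theta> w0)))\<^sup>2
        = (s * energy p g - \<sigma> / s * energy q g)\<^sup>2 / energy g g"
      unfolding B R power_divide by (simp add: energy_nonneg)
    then show ?thesis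
      using energy_polarization_bound[OF Lz(2,3,1) Lg pz pg gg s_nz \<sigma>]
      by (simp add: Jform_eq_energy p_def q_def)
  qed
  have "energy q z \<le> (1/4) * eta_upp_m_sq - (1/4) * eta_low_p\<^sup>2"
    using bound[of vp "- 1" \<theta>p] den_lowp by (simp add: vp_def etauppm_def etalowp_def)
  moreover have "- energy q z \<le> (1/4) * eta_upp_p_sq - (1/4) * eta_low_m\<^sup>2"
    using bound[of vm 1 \<theta>m] den_lowm by (simp add: vm_def etauppp_def etalowm_def)
  ultimately show ?thesis unfolding Q_eq by linarith
qed

end
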